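(* Let $X$ be a real nonzero Banach space and $S,T:X\rightrightarrows X^*$ maximal monotone operators of Gossez type (D) with strong representative functions $h_S,h_T$ such that $\operatorname{pr}_{X^*}(\operatorname{dom}h_S)\cap\operatorname{pr}_{X^*}(\operatorname{dom}h_T)\neq\emptyset$. Then (a) ${}^{ic}(R(S)-R(T))\subseteq{}^{ic}(\operatorname{co}R(S)-\operatorname{co}R(T))\subseteq{}^{ic}\big(\operatorname{pr}_{X^*}(\operatorname{dom}h_S)-\operatorname{pr}_{X^*}(\operatorname{dom}h_T)\big)=\operatorname{ri}\big(\operatorname{pr}_{X^*}(\operatorname{dom}h_S)-\operatorname{pr}_{X^*}(\operatorname{dom}h_T)\big)$; (b) if $0\in{}^{ic}(R(S)-R(T))$ or $0\in{}^{ic}(\operatorname{co}R(S)-\operatorname{co}R(T))$, then $\overline S\|\overline T$ is maximal monotone of Gossez type (D).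
   Context: $X$ identified with its image in $X^{**}$. $G,R$ graph and range; $\operatorname{co}$ convex hull. Coupling $c(x,x^* )=\langle x^*,x\rangle$. Conjugate of $h$ on $X\times X^*$: $h^*(x^*,x^{**})=\sup_{(x,y^* )}\{\langle x^*,x\rangle+\langle x^{**},y^*\rangle-h(x,y^* )\}$. Representative function of monotone $S$: convex norm-lsc $h_S$ with $h_S\ge c$ and $G(S)\subseteq\{h_S=c\}$; strong if $h_S^*(x^*,x^{**})\ge\langle x^{**},x^*\rangle$ for all. Gossez's closure $\overline S:X^{**}\rightrightarrows X^*$ has graph $\{(x^{**},x^* ):\langle x^{**}-y,x^*-y^*\rangle\ge0\ \forall(y,y^* )\in G(S)\}$; maximal monotone $S$ is of Gossez type (D) if each point of $G(\overline S)$ is the $w^*\times\|\cdot\|_*$-limit of a bounded net in $G(S)$. $\overline S\|\overline T(x)=(\overline S^{-1}+\overline T^{-1})^{-1}(x)$ for $x\in X$. $\operatorname{icr}D=\{u:\forall x\in\operatorname{aff}(D-D)\ \exists\delta>0\ \forall\lambda\in[0,\delta]:u+\lambda x\in D\}$; ${}^{ic}D=\operatorname{icr}D$ if $\operatorname{aff}D$ closed, else $\emptyset$; $\operatorname{ri}D$ = interior relative to $\operatorname{aff}D$ if closed, else $\emptyset$. *)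

theory Defs
  imports "HOL-Analysis.Analysis" "HOL-Library.Extended_Real"
begin

type_synonym 'a dual = "'a \<Rightarrow>\<^sub>L real"
type_synonym 'a bidual = "('a \<Rightarrow>\<^sub>L real) \<Rightarrow>\<^sub>L real"

definition graph :: "('a \<Rightarrow> 'b set) \<Rightarrow> ('a \<times> 'b) set" where
  "graph S = {(x, y). y \<in> S x}"

definition range_mf :: "('a \<Rightarrow> 'b set) \<Rightarrow> 'b set" where
  "range_mf S = (\<Union>x. S x)"

definition monotone_op :: "('a::real_normed_vector \<Rightarrow> 'a dual set) \<Rightarrow> bool" where
  "monotone_op S \<longleftrightarrow>
     (\<forall>(x, x') \<in> graph S. \<forall>(y, y') \<in> graph S. (x' - y') (x - y) \<ge> 0)"

definition maximal_monotone :: "('a::real_normed_vector \<Rightarrow> 'a dual set) \<Rightarrow> bool" where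
  "maximal_monotone S \<longleftrightarrow> monotone_op S \<and>
     (\<forall>T. monotone_op T \<and> graph S \<subseteq> graph T \<longrightarrow> graph T = graph S)"

definition coupling :: "'a::real_normed_vector \<times> 'a dual \<Rightarrow> real" where
  "coupling p = (snd p) (fst p)"

definition convex_ereal :: "('b::real_vector \<Rightarrow> ereal) \<Rightarrow> bool" where
  "convex_ereal h \<longleftrightarrow> (\<forall>p q. \<forall>u::real. 0 < u \<and> u < 1 \<longrightarrow>
      h (u *\<^sub>R p + (1 - u) *\<^sub>R q) \<le> ereal u * h p + ereal (1 - u) * h q)"

definition lsc_ereal :: "('b::topological_space \<Rightarrow> ereal) \<Rightarrow> bool" where
  "lsc_ereal h \<longleftrightarrow> (\<forall>z t. t < h z \<longrightarrow> eventually (\<lambda>w. t < h w) (nhds z))"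

definition conj_fun :: "('a::real_normed_vector \<times> 'a dual \<Rightarrow> ereal) \<Rightarrow> 'a dual \<times> 'a bidual \<Rightarrow> ereal" where
  "conj_fun h q = (SUP p. ereal ((fst q) (fst p) + (snd q) (snd p)) - h p)"

definition representative :: "('a::real_normed_vector \<Rightarrow> 'a dual set) \<Rightarrow> ('a \<times> 'a dual \<Rightarrow> ereal) \<Rightarrow> bool" where
  "representative S h \<longleftrightarrow> convex_ereal h \<and> lsc_ereal h \<and>
     (\<forall>p. ereal (coupling p) \<le> h p) \<and> (\<forall>p \<in> graph S. h p = ereal (coupling p))"

definition strong_representative :: "('a::real_normed_vector \<Rightarrow> 'a dual set) \<Rightarrow> ('a \<times> 'a dual \<Rightarrow> ereal) \<Rightarrow> bool" where
  "strong_representative S h \<longleftrightarrow> representative S h \<and>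
     (\<forall>x' x''. conj_fun h (x', x'') \<ge> ereal (x'' x'))"

definition edom :: "('b \<Rightarrow> ereal) \<Rightarrow> 'b set" where
  "edom h = {z. h z < \<infinity>}"

definition gossez_closure :: "('a::real_normed_vector \<Rightarrow> 'a dual set) \<Rightarrow> 'a bidual \<Rightarrow> 'a dual set" where
  "gossez_closure S x'' = {x'. \<forall>(y, y') \<in> graph S. x'' (x' - y') - (x' - y') y \<ge> 0}"

text \<open>Gossez type (D).  A net in G(S) is represented by a proper filter on X \<times> X*
 (the filter of tails of the net); it is bounded if eventually it stays in a bounded set,
 and it converges w* \<times> norm to (x**, x*) if  <y*, x_i> \<rightarrow> x**(y*)  for every y* and x*_i \<rightarrow> x*
 in norm.\<close>
definition gossez_D :: "('a::real_normed_vector \<Rightarrow> 'a dual set) \<Rightarrow> bool" where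
  "gossez_D S \<longleftrightarrow> maximal_monotone S \<and>
     (\<forall>(x'' :: 'a bidual, x' :: 'a dual) \<in> graph (gossez_closure S).
        \<exists>F :: ('a \<times> 'a dual) filter. \<exists>B::real. F \<noteq> bot \<and>
          eventually (\<lambda>p. p \<in> graph S \<and> norm (fst p) \<le> B \<and> norm (snd p) \<le> B) F \<and>
          (\<forall>y'::'a dual. ((\<lambda>p. blinfun_apply y' (fst p)) \<longlongrightarrow> blinfun_apply x'' y') F) \<and>
          (snd \<longlongrightarrow> x') F)"

text \<open>(S-bar || T-bar)(x) = (S-bar^{-1} + T-bar^{-1})^{-1}(x) for x in X.\<close>
definition parallel_sum :: "('a::real_normed_vector \<Rightarrow> 'a dual set) \<Rightarrow> ('a \<Rightarrow> 'a dual set) \<Rightarrow> 'a \<Rightarrow> 'a dual set" where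
  "parallel_sum S T x = {x'. \<exists>u v. x' \<in> gossez_closure S u \<and> x' \<in> gossez_closure T v \<and>
        (\<forall>f. u f + v f = f x)}"

definition set_diff :: "'b::ab_group_add set \<Rightarrow> 'b set \<Rightarrow> 'b set" where
  "set_diff A B = {a - b | a b. a \<in> A \<and> b \<in> B}"

definition icr :: "'b::real_vector set \<Rightarrow> 'b set" where
  "icr D = {u. \<forall>x \<in> affine hull (set_diff D D). \<exists>\<delta>>0. \<forall>l\<in>{0..\<delta>}. u + l *\<^sub>R x \<in> D}"

definition ic :: "'b::real_normed_vector set \<Rightarrow> 'b set" where
  "ic D = (if closed (affine hull D) then icr D else {})"

definition ri :: "'b::real_normed_vector set \<Rightarrow> 'b set" where
  "ri D = (if closed (affine hull D) then rel_interior D else {})"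

end

theory Submission
  imports Defs
begin

text \<open>
  Write \<open>E\<close> for the set of all \<open>(u + v, a, s + t)\<close> with \<open>(u, a, s)\<close> above the graph of \<open>h\<^sub>S\<close> and
  \<open>(v, a, t)\<close> above the graph of \<open>h\<^sub>T\<close>. If \<open>0\<close> is in the relative algebraic interior of the
  difference of the projected domains, a Robinson-Ursescu argument (Baire category and a geometric
  series) and Hahn-Banach give Attouch-Brezis duality: the conjugate of \<open>E\<close> is an exact infimal
  convolution of the conjugates of \<open>h\<^sub>S\<close> and \<open>h\<^sub>T\<close>. Hence it dominates the duality product, and it
  attains it at \<open>(x\<^sup>*, x)\<close> with \<open>x\<close> in \<open>X\<close> exactly on the graph of the parallel sum.

  Any convex set \<open>E\<close> that lies above the duality product together with its conjugate yields an
  operator of type (D), by the method of Marques Alves and Svaiter. Fenchel duality with squared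
  norms gives a strict Bronsted-Rockafellar property, hence maximality and, with weighted norms,
  condition (NI). Condition (NI) says that the convex hull of the graph, lifted by the duality
  product, is again such a set; its conjugate equals the duality product on Gossez's closure. So a
  point of the closure is a bounded weak* limit of points of the hull at which the height is
  close to the duality product, and these are close in norm to points of the graph.

  For the inclusions, the point is that a functional annihilating the differences of a range
  also annihilates the differences of the projected domain, so that all the sets involved have the
  same affine hull as soon as the smallest of these hulls is closed.
\<close>

section \<open>Hahn-Banach and Lagrange multipliers\<close>

definition sublinear :: "('v::real_vector \<Rightarrow> real) \<Rightarrow> bool" where
  "sublinear p \<longleftrightarrow> (\<forall>x y. p (x + y) \<le> p x + p y) \<and> (\<forall>t>0. \<forall>x. p (t *\<^sub>R x) = t * p x)"

lemma sublinear_zero: "sublinear p \<Longrightarrow> p 0 = 0"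
  unfolding sublinear_def by (metis (no_types) add_cancel_right_right mult_2 scale_zero_right zero_less_numeral)

lemma sublinear_minus:
  assumes "sublinear p"
  shows "- p (- x) \<le> p x"
proof -
  have "p (x + - x) \<le> p x + p (- x)" using assms unfolding sublinear_def by blast
  then show ?thesis using sublinear_zero[OF assms] by simp
qed

text \<open>An infimum over a family of upper estimates is sublinear as soon as estimates can be
  added and scaled within the family. It supplies the lower bound of a chain, the descent step of
  the Hahn-Banach argument and the penalty functional of \<open>norm_penalty_linear\<close>.\<close>

lemma sublinear_Inf:
  fixes Q :: "'v::real_vector \<Rightarrow> real set"
  assumes ne: "\<And>x. Q x \<noteq> {}" and bdd: "\<And>x. bdd_below (Q x)"
    and add: "\<And>x y a b. a \<in> Q x \<Longrightarrow> b \<in> Q y \<Longrightarrow> \<exists>c\<in>Q (x + y). c \<le> a + b"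
    and scale: "\<And>t x a. t > 0 \<Longrightarrow> a \<in> Q x \<Longrightarrow> \<exists>c\<in>Q (t *\<^sub>R x). c \<le> t * a"
  shows "sublinear (\<lambda>x. Inf (Q x))"
proof -
  have 1: "Inf (Q (x + y)) \<le> Inf (Q x) + Inf (Q y)" for x y
  proof -
    have "Inf (Q (x + y)) \<le> a + b" if "a \<in> Q x" "b \<in> Q y" for a b
      using add[OF that] bdd by (meson cInf_lower order_trans)
    then have "Inf (Q (x + y)) - a \<le> Inf (Q y)" if "a \<in> Q x" for a
      by (intro cInf_greatest[OF ne]) (use that in fastforce)
    then have "Inf (Q (x + y)) - Inf (Q y) \<le> Inf (Q x)"
      by (intro cInf_greatest[OF ne]) fastforce
    then show ?thesis by simp
  qed
  have 2: "Inf (Q (t *\<^sub>R x)) \<le> t * Inf (Q x)" if "t > 0" for t x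
  proof -
    have "Inf (Q (t *\<^sub>R x)) / t \<le> Inf (Q x)"
    proof (intro cInf_greatest[OF ne])
      fix a assume "a \<in> Q x"
      then have "Inf (Q (t *\<^sub>R x)) \<le> t * a"
        using scale[OF that] bdd by (meson cInf_lower order_trans)
      then show "Inf (Q (t *\<^sub>R x)) / t \<le> a" using that by (simp add: divide_simps mult.commute)
    qed
    then show ?thesis using that by (simp add: divide_simps mult.commute)
  qed
  have 3: "Inf (Q (t *\<^sub>R x)) = t * Inf (Q x)" if "t > 0" for t x
  proof (rule antisym[OF 2[OF that]])
    show "t * Inf (Q x) \<le> Inf (Q (t *\<^sub>R x))"
      using 2[of "1/t" "t *\<^sub>R x"] that by (simp add: divide_simps mult.commute)
  qed
  show ?thesis unfolding sublinear_def using 1 3 by auto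
qed

text \<open>A minimal sublinear functional below \<open>p\<close> is additive, since otherwise it
  could be lowered further along some ray; with positive homogeneity it is then linear.\<close>

theorem sublinear_dominates_linear:
  fixes p :: "'v::real_vector \<Rightarrow> real"
  assumes p: "sublinear p"
  shows "\<exists>f. linear f \<and> (\<forall>x. f x \<le> p x)"
proof -
  \<comment> \<open>The order is reversed, so that the maximal element given by Zorn's lemma is a
    minimal functional.\<close>
  let ?A = "{q. sublinear q \<and> q \<le> p}" and ?P = "\<lambda>a b :: 'v \<Rightarrow> real. b \<le> a"
  have "\<exists>m\<in>?A. \<forall>a\<in>?A. ?P m a \<longrightarrow> a = m"
  proof (rule predicate_Zorn)
    show "partial_order_on ?A (relation_of ?P ?A)"
      by (rule partial_order_on_relation_ofI) auto
    fix C assume C: "C \<in> Chains (relation_of ?P ?A)"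
    then have CA: "C \<subseteq> ?A" and tot: "\<And>a b. a \<in> C \<Longrightarrow> b \<in> C \<Longrightarrow> a \<le> b \<or> b \<le> a"
      by (auto simp: Chains_def relation_of_def)
    show "\<exists>u\<in>?A. \<forall>a\<in>C. ?P a u"
    proof (cases "C = {}")
      case True then show ?thesis using p by auto
    next
      case False
      then obtain q0 where q0: "q0 \<in> C" by auto
      \<comment> \<open>The lower bound of the chain is its pointwise infimum, finite because
        \<open>q x\<close> is at least \<open>- p (- x)\<close>.\<close>
      let ?Q = "\<lambda>x. (\<lambda>q. q x) ` C"
      have bdd: "bdd_below (?Q x)" for x
      proof (rule bdd_belowI2)
        fix q assume "q \<in> C"
        then have "sublinear q" "q (-x) \<le> p (-x)" using CA by (auto simp: le_fun_def)
        then show "- p (- x) \<le> q x" using sublinear_minus[of q x] by linarith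
      qed
      have "sublinear (\<lambda>x. Inf (?Q x))"
      proof (rule sublinear_Inf)
        show "?Q x \<noteq> {}" for x using False by simp
        show "bdd_below (?Q x)" for x by (rule bdd)
        show "\<exists>c\<in>?Q (x + y). c \<le> a + b" if a: "a \<in> ?Q x" and b: "b \<in> ?Q y" for x y a b
        proof -
          obtain q r where qr: "q \<in> C" "a = q x" "r \<in> C" "b = r y" using a b by blast
          obtain s where s: "s \<in> C" "s \<le> q" "s \<le> r" using tot[OF qr(1,3)] qr by auto
          have "s (x + y) \<le> s x + s y" using s CA by (auto simp: sublinear_def)
          also have "\<dots> \<le> a + b" using s qr by (auto simp: le_fun_def intro: add_mono)
          finally show ?thesis using s by blast
        qed
        show "\<exists>c\<in>?Q (t *\<^sub>R x). c \<le> t * a" if t: "0 < t" and a: "a \<in> ?Q x" for t x a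
        proof -
          obtain q where "q \<in> C" "a = q x" using a by blast
          moreover then have "q (t *\<^sub>R x) = t * q x" using t CA by (auto simp: sublinear_def)
          ultimately show ?thesis by (metis imageI order_refl)
        qed
      qed
      moreover have low: "Inf (?Q x) \<le> q x" if "q \<in> C" for q x
        using bdd that by (auto intro: cInf_lower)
      moreover have "Inf (?Q x) \<le> p x" for x using low[OF q0, of x] CA q0 by (auto simp: le_fun_def intro: order_trans)
      ultimately show ?thesis by (intro bexI[of _ "\<lambda>x. Inf (?Q x)"]) (auto simp: le_fun_def)
    qed
  qed
  then obtain q where q: "sublinear q" "q \<le> p" and min: "\<And>a. sublinear a \<Longrightarrow> a \<le> p \<Longrightarrow> a \<le> q \<Longrightarrow> a = q"
    by auto
  have qa: "q (x + y) \<le> q x + q y" for x y using q by (auto simp: sublinear_def)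
  have qs: "t > 0 \<Longrightarrow> q (t *\<^sub>R x) = t * q x" for x t using q by (auto simp: sublinear_def)
  have qs0: "t \<ge> 0 \<Longrightarrow> q (t *\<^sub>R x) = t * q x" for x t
    using qs sublinear_zero[OF q(1)] by (cases "t = 0") auto
  have add: "q (x + y) = q x + q y" for x y
  proof -
    \<comment> \<open>Lowering \<open>q\<close> along the ray of \<open>y\<close> yields a sublinear
      functional below \<open>q\<close>, hence \<open>q\<close> itself by minimality; the entry
      \<open>t = 1\<close> then bounds \<open>q x + q y\<close> by \<open>q (x + y)\<close>.\<close>
    let ?Q = "\<lambda>x. (\<lambda>t. q (x + t *\<^sub>R y) - t * q y) ` {0..}"
    have bdd: "bdd_below (?Q x)" for x
    proof (rule bdd_belowI2)
      fix t :: real assume "t \<in> {0..}"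
      then have "t * q y = q (t *\<^sub>R y)" using qs0 by simp
      also have "\<dots> \<le> q (x + t *\<^sub>R y) + q (- x)" using qa[of "x + t *\<^sub>R y" "-x"] by simp
      finally show "- q (- x) \<le> q (x + t *\<^sub>R y) - t * q y" by simp
    qed
    have "sublinear (\<lambda>x. Inf (?Q x))"
    proof (rule sublinear_Inf)
      show "?Q x \<noteq> {}" for x by auto
      show "bdd_below (?Q x)" for x by (rule bdd)
      show "\<exists>c\<in>?Q (x + z). c \<le> a + b" if a: "a \<in> ?Q x" and b: "b \<in> ?Q z" for x z a b
      proof -
        obtain t s where ts: "t \<ge> 0" "a = q (x + t *\<^sub>R y) - t * q y" "s \<ge> 0" "b = q (z + s *\<^sub>R y) - s * q y" using a b by auto
        have "q ((x + z) + (t + s) *\<^sub>R y) - (t + s) * q y \<le> a + b"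
          using qa[of "x + t *\<^sub>R y" "z + s *\<^sub>R y"] ts by (simp add: algebra_simps)
        then show ?thesis using ts by (intro bexI[of _ "q ((x + z) + (t + s) *\<^sub>R y) - (t + s) * q y"]) auto
      qed
      show "\<exists>c\<in>?Q (s *\<^sub>R x). c \<le> s * a" if s: "0 < s" and a: "a \<in> ?Q x" for s x a
      proof -
        obtain t where t: "t \<ge> 0" "a = q (x + t *\<^sub>R y) - t * q y" using a by auto
        have "q (s *\<^sub>R x + (s * t) *\<^sub>R y) - (s * t) * q y = s * a"
          using qs[OF s, of "x + t *\<^sub>R y"] unfolding t(2) by (simp add: scaleR_add_right right_diff_distrib mult.assoc)
        then show ?thesis using s t
          by (intro bexI[of _ "q (s *\<^sub>R x + (s * t) *\<^sub>R y) - (s * t) * q y"]) (auto intro!: image_eqI[of _ _ "s * t"])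
      qed
    qed
    moreover have le: "Inf (?Q z) \<le> q (z + t *\<^sub>R y) - t * q y" if "t \<ge> 0" for z t
      using bdd that by (auto intro: cInf_lower)
    moreover have le0: "Inf (?Q z) \<le> q z" for z using le[of 0 z] by simp
    moreover have "Inf (?Q z) \<le> p z" for z using le0[of z] q by (auto simp: le_fun_def intro: order_trans)
    ultimately have "(\<lambda>x. Inf (?Q x)) = q"
      by (intro min) (auto simp: le_fun_def)
    then have "q x \<le> q (x + y) - q y" using le[of 1 x] by (simp add: fun_eq_iff)
    then show ?thesis using qa[of x y] by linarith
  qed
  have neg: "q (- x) = - q x" for x using add[of x "-x"] sublinear_zero[OF q(1)] by simp
  have "q (t *\<^sub>R x) = t *\<^sub>R q x" for t x
    using qs0[of t x] qs0[of "-t" x] neg[of "t *\<^sub>R x"] by (cases "t \<ge> 0") auto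
  then have "linear q" using add by (auto intro: linearI)
  then show ?thesis using q by (auto simp: le_fun_def)
qed

text \<open>The functional is a linear minorant of the infimum of \<open>Q\<close>: entries with
  \<open>l = 0\<close> bound it by \<open>K\<close> times the norm, and the entry with
  \<open>l = 1\<close> at \<open>- j c\<close> is the claimed inequality. The map \<open>j\<close>
  is only assumed affine, so translations are allowed.\<close>

theorem norm_penalty_linear:
  fixes j :: "'c::real_vector \<Rightarrow> 'e::real_normed_vector"
  assumes ne: "C \<noteq> {}" and k: "convex_on C k"
    and j: "\<And>x y t. j ((1 - t) *\<^sub>R x + t *\<^sub>R y) = (1 - t) *\<^sub>R j x + t *\<^sub>R j y"
    and K: "K \<ge> 0" and m: "\<And>c. c \<in> C \<Longrightarrow> m \<le> K * norm (j c) + k c"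
  shows "\<exists>f :: 'e \<Rightarrow>\<^sub>L real. \<forall>c\<in>C. m \<le> f (j c) + k c"
proof -
  define Q where "Q v = {K * norm (v + l *\<^sub>R j c) + l * (k c - m) | l c. l \<ge> 0 \<and> c \<in> C}" for v
  obtain c0 where c0: "c0 \<in> C" using ne by auto
  have Q0: "K * norm v \<in> Q v" for v
    unfolding Q_def using c0 by (intro CollectI exI[of _ 0] exI[of _ c0]) auto
  have low: "- K * norm v \<le> a" if a: "a \<in> Q v" for v a
  proof -
    obtain l c where lc: "a = K * norm (v + l *\<^sub>R j c) + l * (k c - m)" "l \<ge> 0" "c \<in> C"
      using a unfolding Q_def by blast
    have "norm (l *\<^sub>R j c) \<le> norm (v + l *\<^sub>R j c) + norm v"
      using norm_triangle_ineq4[of "v + l *\<^sub>R j c" v] by simp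
    then have "K * norm (l *\<^sub>R j c) \<le> K * norm (v + l *\<^sub>R j c) + K * norm v"
      using mult_left_mono[OF _ K] by (simp only: flip: distrib_left)
    moreover have "l * m \<le> l * (K * norm (j c) + k c)"
      using m[OF lc(3)] lc(2) by (intro mult_left_mono) auto
    ultimately show ?thesis using lc by (simp add: algebra_simps)
  qed
  then have bdd: "bdd_below (Q v)" for v by (meson bdd_belowI)
  have "sublinear (\<lambda>v. Inf (Q v))"
  proof (rule sublinear_Inf)
    show "Q v \<noteq> {}" for v using Q0 by auto
    show "bdd_below (Q v)" for v by (rule bdd)
    show "\<exists>c\<in>Q (x + y). c \<le> a + b" if a: "a \<in> Q x" and b: "b \<in> Q y" for x y a b
    proof -
      obtain l c where lc: "a = K * norm (x + l *\<^sub>R j c) + l * (k c - m)" "l \<ge> 0" "c \<in> C"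
        using a unfolding Q_def by blast
      obtain l' c' where lc': "b = K * norm (y + l' *\<^sub>R j c') + l' * (k c' - m)" "l' \<ge> 0" "c' \<in> C"
        using b unfolding Q_def by blast
      show ?thesis
      proof (cases "l + l' = 0")
        case True
        then have "l = 0" "l' = 0" using lc lc' by auto
        then have "K * norm (x + y) \<le> a + b" using lc lc' K
          by (simp flip: distrib_left add: mult_left_mono norm_triangle_ineq)
        then show ?thesis using Q0 by blast
      next
        case False
        \<comment> \<open>The rays through \<open>c\<close> and \<open>c'\<close> are merged into
          one through their weighted mean \<open>d\<close>, with total weight
          \<open>l + l'\<close>.\<close>
        define t where "t = l' / (l + l')"
        have t: "0 \<le> t" "t \<le> 1" "(l + l') * t = l'" "(l + l') * (1 - t) = l" using False lc lc'
          by (auto simp: t_def field_simps)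
        define d where "d = (1 - t) *\<^sub>R c + t *\<^sub>R c'"
        have d: "d \<in> C" using convex_on_imp_convex[OF k] lc lc' t unfolding d_def by (simp add: convexD_alt)
        have "k d \<le> (1 - t) * k c + t * k c'"
          using k lc lc' t unfolding d_def by (auto simp: convex_on_def)
        then have "(l + l') * k d \<le> (l + l') * ((1 - t) * k c + t * k c')" using lc lc' by (intro mult_left_mono) auto
        also have "\<dots> = ((l + l') * (1 - t)) * k c + ((l + l') * t) * k c'" by (simp add: algebra_simps)
        finally have kd: "(l + l') * k d \<le> l * k c + l' * k c'" using t by simp
        have "(l + l') *\<^sub>R j d = ((l + l') * (1 - t)) *\<^sub>R j c + ((l + l') * t) *\<^sub>R j c'"
          unfolding d_def j by (simp add: scaleR_add_right)
        then have jd: "(l + l') *\<^sub>R j d = l *\<^sub>R j c + l' *\<^sub>R j c'" using t by simp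
        have "norm ((x + y) + (l + l') *\<^sub>R j d) \<le> norm (x + l *\<^sub>R j c) + norm (y + l' *\<^sub>R j c')"
          unfolding jd using norm_triangle_ineq[of "x + l *\<^sub>R j c" "y + l' *\<^sub>R j c'"] by (simp add: algebra_simps)
        then have "K * norm ((x + y) + (l + l') *\<^sub>R j d) \<le> K * norm (x + l *\<^sub>R j c) + K * norm (y + l' *\<^sub>R j c')"
          using K by (simp flip: distrib_left add: mult_left_mono)
        then have "K * norm ((x + y) + (l + l') *\<^sub>R j d) + (l + l') * (k d - m) \<le> a + b"
          using kd lc lc' by (simp add: algebra_simps)
        moreover have "K * norm ((x + y) + (l + l') *\<^sub>R j d) + (l + l') * (k d - m) \<in> Q (x + y)"
          using d lc(2) lc'(2) unfolding Q_def by (intro CollectI exI[of _ "l + l'"] exI[of _ d]) simp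
        ultimately show ?thesis by blast
      qed
    qed
    show "\<exists>c\<in>Q (t *\<^sub>R x). c \<le> t * a" if t: "0 < t" and a: "a \<in> Q x" for t x a
    proof -
      obtain l c where lc: "a = K * norm (x + l *\<^sub>R j c) + l * (k c - m)" "l \<ge> 0" "c \<in> C"
        using a unfolding Q_def by blast
      have "norm (t *\<^sub>R x + (t * l) *\<^sub>R j c) = t * norm (x + l *\<^sub>R j c)"
        using t by (simp flip: scaleR_scaleR scaleR_add_right)
      then have "t * a = K * norm (t *\<^sub>R x + (t * l) *\<^sub>R j c) + (t * l) * (k c - m)"
        unfolding lc(1) by (simp add: distrib_left)
      then have "t * a \<in> Q (t *\<^sub>R x)" unfolding Q_def using lc t by (intro CollectI exI[of _ "t * l"] exI[of _ c]) auto
      then show ?thesis by blast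
    qed
  qed
  then obtain f where f: "linear f" "\<And>v. f v \<le> Inf (Q v)"
    using sublinear_dominates_linear by blast
  have fQ: "f v \<le> a" if "a \<in> Q v" for a v using f(2)[of v] that bdd by (meson cInf_lower order_trans)
  have "norm (f v) \<le> norm v * K" for v
    using fQ[OF Q0, of v] fQ[OF Q0, of "-v"] linear_neg[OF f(1), of v] by (auto simp: abs_le_iff mult.commute)
  then have bl: "bounded_linear f"
    using f(1) by (intro bounded_linear_intro[where K = K]) (auto simp: linear_add linear_scale)
  have "m \<le> f (j c) + k c" if "c \<in> C" for c
  proof -
    have "k c - m \<in> Q (- j c)" unfolding Q_def using that by (intro CollectI exI[of _ 1] exI[of _ c]) auto
    from fQ[OF this] show ?thesis using linear_neg[OF f(1), of "j c"] by simp
  qed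
  then show ?thesis using bl by (intro exI[of _ "Blinfun f"]) (auto simp: bounded_linear_Blinfun_apply)
qed

text \<open>The Slater condition makes a norm penalty exact: every infeasible \<open>c\<close> is
  joined by a segment to some \<open>c'\<close> on the opposite side, and convexity along it bounds
  the gain from violating the constraint by the slope \<open>(M - m) / d\<close>.\<close>

theorem qualified_constraint_multiplier:
  fixes j :: "'c::real_vector \<Rightarrow> 'e::real_normed_vector"
  assumes ne: "C \<noteq> {}" and k: "convex_on C k"
    and j: "\<And>x y t. j ((1 - t) *\<^sub>R x + t *\<^sub>R y) = (1 - t) *\<^sub>R j x + t *\<^sub>R j y"
    and L: "subspace L" "j ` C \<subseteq> L" and d: "d > 0"
    and bd: "\<And>v. v \<in> L \<Longrightarrow> norm v \<le> d \<Longrightarrow> \<exists>c\<in>C. j c = v \<and> k c \<le> M"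
    and m: "\<And>c. c \<in> C \<Longrightarrow> j c = 0 \<Longrightarrow> m \<le> k c"
  shows "\<exists>f :: 'e \<Rightarrow>\<^sub>L real. \<forall>c\<in>C. m \<le> f (j c) + k c"
proof -
  obtain c0 where "c0 \<in> C" "j c0 = 0" "k c0 \<le> M" using bd[of 0] L(1) d by (auto simp: subspace_0)
  then have mM: "m \<le> M" using m by force
  show ?thesis
  proof (rule norm_penalty_linear[OF ne k j, of "(M - m) / d"])
    show "0 \<le> (M - m) / d" using mM d by simp
    fix c assume c: "c \<in> C"
    show "m \<le> (M - m) / d * norm (j c) + k c"
    proof (cases "j c = 0")
      case True then show ?thesis using m[OF c] by simp
    next
      case False
      define n where "n = norm (j c)"
      have n: "n > 0" using False by (simp add: n_def)
      have "(- d / n) *\<^sub>R j c \<in> L" using L c by (meson image_subset_iff subspace_scale)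
      moreover have "norm ((- d / n) *\<^sub>R j c) \<le> d" using d n by (simp add: n_def)
      ultimately obtain c' where c': "c' \<in> C" "j c' = (- d / n) *\<^sub>R j c" "k c' \<le> M" using bd by blast
      \<comment> \<open>With this weight the images of \<open>c'\<close> and \<open>c\<close>
        cancel, so the combination is feasible.\<close>
      define t where "t = d / (d + n)"
      have t: "0 \<le> t" "t \<le> 1" "1 - t = n / (d + n)" using d n by (auto simp: t_def field_simps)
      have "j ((1 - t) *\<^sub>R c' + t *\<^sub>R c) = ((1 - t) * (- d / n) + t) *\<^sub>R j c"
        unfolding j c' by (simp only: scaleR_scaleR scaleR_add_left)
      also have "(1 - t) * (- d / n) + t = 0" using n unfolding t(3) by (simp add: t_def)
      finally have "j ((1 - t) *\<^sub>R c' + t *\<^sub>R c) = 0" by simp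
      moreover have "(1 - t) *\<^sub>R c' + t *\<^sub>R c \<in> C" using convexD_alt[OF convex_on_imp_convex[OF k] c'(1) c t(1,2)] .
      ultimately have "m \<le> k ((1 - t) *\<^sub>R c' + t *\<^sub>R c)" using m by blast
      also have "\<dots> \<le> (1 - t) * k c' + t * k c"
        using k c c'(1) t(1,2) by (auto simp: convex_on_def)
      also have "\<dots> \<le> (1 - t) * M + t * k c" using c'(3) t(1,2) by (intro add_right_mono mult_left_mono) auto
      finally have "m \<le> n / (d + n) * M + d / (d + n) * k c" unfolding t(3) by (simp only: t_def)
      then have "(d + n) * m \<le> (d + n) * (n / (d + n) * M + d / (d + n) * k c)"
        using d n by (intro mult_left_mono) auto
      then have "(d + n) * m \<le> n * M + d * k c" using d n by (simp add: distrib_left)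
      then show ?thesis using d by (fold n_def) (simp add: field_simps)
    qed
  qed
qed

text \<open>The absolute values are linearised one at a time: the remaining ones stay in the convex
  cost, and the linear term obtained is absorbed into \<open>k\<close> before the induction
  hypothesis is applied.\<close>

lemma finite_abs_penalty_linear:
  fixes l :: "'i \<Rightarrow> 'c::real_vector \<Rightarrow> real"
  assumes F: "finite F" and ne: "C \<noteq> {}" and K: "K \<ge> 0"
    and l: "\<And>i x y t. l i ((1 - t) *\<^sub>R x + t *\<^sub>R y) = (1 - t) * l i x + t * l i y"
    and k: "convex_on C k" and m: "\<And>c. c \<in> C \<Longrightarrow> m \<le> (\<Sum>i\<in>F. K * \<bar>l i c\<bar>) + k c"
  shows "\<exists>a. \<forall>c\<in>C. m \<le> (\<Sum>i\<in>F. a i * l i c) + k c"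
  using F k m
proof (induction F arbitrary: k rule: finite_induct)
  case empty
  then show ?case by auto
next
  case (insert i F)
  have conv_abs: "convex_on C (\<lambda>c. K * \<bar>l i c\<bar>)" for i
  proof (rule convex_on_cmul[OF K], rule convex_onI)
    show "convex C" by (rule convex_on_imp_convex[OF insert.prems(1)])
    show "\<bar>l i ((1 - t) *\<^sub>R x + t *\<^sub>R y)\<bar> \<le> (1 - t) * \<bar>l i x\<bar> + t * \<bar>l i y\<bar>" if "0 < t" "t < 1" for t x y
      unfolding l using that abs_triangle_ineq[of "(1 - t) * l i x" "t * l i y"] by (simp add: abs_mult)
  qed
  have "convex_on C (\<lambda>c. (\<Sum>i\<in>F. K * \<bar>l i c\<bar>))"
    using insert.hyps(1) by (induction F rule: finite_induct)
      (auto intro!: convex_on_add conv_abs simp: convex_on_const convex_on_imp_convex[OF insert.prems(1)])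
  then have "convex_on C (\<lambda>c. (\<Sum>i\<in>F. K * \<bar>l i c\<bar>) + k c)"
    by (intro convex_on_add insert.prems(1))
  from norm_penalty_linear[OF ne this, of "l i" K m] obtain f :: "real \<Rightarrow>\<^sub>L real"
    where f: "\<And>c. c \<in> C \<Longrightarrow> m \<le> f (l i c) + ((\<Sum>i\<in>F. K * \<bar>l i c\<bar>) + k c)"
    using insert.prems(2) insert.hyps K l by (auto simp: add.assoc) metis
  have fm: "f x = f 1 * x" for x using blinfun.scaleR_right[of f x 1] by simp
  have "convex_on C (\<lambda>c. f 1 * l i c + k c)"
  proof (intro convex_on_add insert.prems(1) convex_onI)
    show "convex C" by (rule convex_on_imp_convex[OF insert.prems(1)])
    show "f 1 * l i ((1 - t) *\<^sub>R x + t *\<^sub>R y) \<le> (1 - t) * (f 1 * l i x) + t * (f 1 * l i y)" for t x y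
      unfolding l by (simp only: distrib_left mult.left_commute order_refl)
  qed
  moreover have "m \<le> (\<Sum>i\<in>F. K * \<bar>l i c\<bar>) + (f 1 * l i c + k c)" if "c \<in> C" for c
    using f[OF that] fm[of "l i c"] by linarith
  ultimately obtain a where a: "\<And>c. c \<in> C \<Longrightarrow> m \<le> (\<Sum>i\<in>F. a i * l i c) + (f 1 * l i c + k c)"
    using insert.IH by blast
  show ?case
  proof (intro exI[of _ "a(i := f 1)"] ballI)
    fix c assume "c \<in> C"
    have "(\<Sum>j\<in>insert i F. (a(i := f 1)) j * l j c) = f 1 * l i c + (\<Sum>j\<in>F. a j * l j c)"
      using insert.hyps by (simp, intro sum.cong) auto
    then show "m \<le> (\<Sum>j\<in>insert i F. (a(i := f 1)) j * l j c) + k c" using a[OF \<open>c \<in> C\<close>] by simp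
  qed
qed

section \<open>Relative interiors of linear images of convex sets\<close>

text \<open>Successive approximation as in the open mapping theorem, with residuals doubled at every
  step. The corrections carry the weights 1/2, 1/4, ..., whose sum is 1, so convexity keeps the
  limit in \<open>C\<close> and in the ball; this is why half of \<open>y\<close> is
  reached.\<close>

lemma convex_image_dense_open:
  fixes j :: "'c::banach \<Rightarrow> 'e::banach"
  assumes C: "convex C" "closed C" "0 \<in> C" and j: "bounded_linear j"
    and L: "subspace L" "j ` C \<subseteq> L" and r: "r > 0"
    and dense: "\<And>v. v \<in> L \<Longrightarrow> norm v < r \<Longrightarrow> v \<in> closure (j ` (C \<inter> cball 0 N))"
    and y: "y \<in> L" "norm y < r"
  shows "\<exists>c\<in>C. norm c \<le> N \<and> j c = (1/2) *\<^sub>R y"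
proof -
  interpret j: bounded_linear j by (rule j)
  have "\<exists>c. c \<in> C \<inter> cball 0 N \<and> norm (v - j c) < r / 2" if "v \<in> L" "norm v < r" for v
    using dense[OF that] r by (auto simp: closure_approachable dist_norm norm_minus_commute dest!: spec[of _ "r/2"])
  then obtain g where g: "\<And>v. v \<in> L \<Longrightarrow> norm v < r \<Longrightarrow> g v \<in> C \<inter> cball 0 N \<and> norm (v - j (g v)) < r / 2"
    by metis
  define z where "z = rec_nat y (\<lambda>_ v. 2 *\<^sub>R (v - j (g v)))"
  have z0: "z 0 = y" and zS: "z (Suc n) = 2 *\<^sub>R (z n - j (g (z n)))" for n by (auto simp: z_def)
  have z: "z n \<in> L \<and> norm (z n) < r" for n
  proof (induction n)
    case 0 then show ?case using y z0 by simp
  next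
    case (Suc n)
    then have "j (g (z n)) \<in> L" using g L by blast
    then show ?case using Suc g[of "z n"] L unfolding zS by (auto intro!: subspace_scale subspace_diff)
  qed
  define c where "c n = (1/2) ^ Suc n *\<^sub>R g (z n)" for n
  have N: "0 \<le> N" using g[of y] y by (auto intro: order_trans[OF norm_ge_zero])
  have "norm (c n) \<le> (1/2) ^ n * N" for n
  proof -
    have "norm (g (z n)) \<le> N" using g z by auto
    then have "(1/2) ^ Suc n * norm (g (z n)) \<le> (1/2) ^ n * N" using N by (intro mult_mono) auto
    then show ?thesis by (simp add: c_def)
  qed
  then have sumc: "summable c"
    by (intro summable_comparison_test[of c "\<lambda>n. (1/2) ^ n * N"] exI[of _ 0] allI impI summable_mult2 summable_geometric) auto
  \<comment> \<open>The weight \<open>(1/2) ^ n\<close> left over after \<open>n\<close> steps goes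
    to an arbitrary point \<open>a\<close>, which makes the induction work; \<open>a = 0\<close>
    gives the partial sums.\<close>
  have part: "(\<Sum>i<n. c i) + (1/2) ^ n *\<^sub>R a \<in> C \<inter> cball 0 N" if "a \<in> C \<inter> cball 0 N" for n a
    using that
  proof (induction n arbitrary: a)
    case 0 then show ?case by simp
  next
    case (Suc n)
    have "convex (C \<inter> cball 0 N)" using C by (intro convex_Int) auto
    then have "(1/2) *\<^sub>R g (z n) + (1/2) *\<^sub>R a \<in> C \<inter> cball 0 N"
      using convexD[of "C \<inter> cball 0 N" "g (z n)" a "1/2" "1/2"] g z Suc.prems by auto
    then have "(\<Sum>i<n. c i) + (1/2) ^ n *\<^sub>R ((1/2) *\<^sub>R g (z n) + (1/2) *\<^sub>R a) \<in> C \<inter> cball 0 N"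
      by (rule Suc.IH)
    then show ?case by (simp add: c_def scaleR_add_right add.assoc)
  qed
  have "0 \<in> C \<inter> cball 0 N" using C N by simp
  then have "(\<Sum>i<n. c i) \<in> C \<inter> cball 0 N" for n using part[of 0 n] by simp
  moreover have "closed (C \<inter> cball 0 N)" using C by auto
  ultimately have lim: "suminf c \<in> C \<inter> cball 0 N"
    using summable_LIMSEQ[OF sumc] by (meson closed_sequentially)
  have id: "(1/2) *\<^sub>R y = j (\<Sum>i<n. c i) + (1/2) ^ Suc n *\<^sub>R z n" for n
  proof (induction n)
    case 0 then show ?case by (simp add: z0 j.zero)
  next
    case (Suc n)
    have "(1/2) ^ Suc (Suc n) *\<^sub>R z (Suc n) = (1/2) ^ Suc n *\<^sub>R z n - j (c n)"
      unfolding zS c_def by (simp add: j.scaleR scaleR_diff_right)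
    then show ?case using Suc by (simp add: j.add)
  qed
  have "(\<lambda>n. (1/2) ^ Suc n *\<^sub>R z n) \<longlonglongrightarrow> 0"
  proof (rule Lim_null_comparison)
    show "\<forall>\<^sub>F n in sequentially. norm ((1/2) ^ Suc n *\<^sub>R z n) \<le> (1/2) ^ n * r"
    proof (intro always_eventually allI)
      fix n
      have "(1/2) ^ Suc n * norm (z n) \<le> (1/2) ^ n * r" using z[of n] by (intro mult_mono) auto
      then show "norm ((1/2) ^ Suc n *\<^sub>R z n) \<le> (1/2) ^ n * r" by simp
    qed
    show "(\<lambda>n. (1/2) ^ n * r) \<longlonglongrightarrow> 0" by (intro tendsto_mult_left_zero LIMSEQ_power_zero) auto
  qed
  from tendsto_add[OF j.tendsto[OF summable_LIMSEQ[OF sumc]] this]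
  have "(1/2) *\<^sub>R y = j (suminf c)" 
    unfolding id[symmetric] add_0_right by (simp only: LIMSEQ_const_iff)
  then show ?thesis using lim by (intro bexI[of _ "suminf c"]) auto
qed

text \<open>Robinson-Ursescu argument: Baire's theorem in \<open>L\<close> gives, up to scaling, a
  relative ball in the closure of the image of a bounded part; absorption moves it to the origin,
  and \<open>convex_image_dense_open\<close> removes the closure.\<close>

lemma convex_absorbing_image_open:
  fixes j :: "'c::banach \<Rightarrow> 'e::banach"
  assumes C: "convex C" "closed C" "0 \<in> C" and j: "bounded_linear j"
    and L: "subspace L" "closed L" "j ` C \<subseteq> L"
    and abs: "\<And>x. x \<in> L \<Longrightarrow> \<exists>t>0. t *\<^sub>R x \<in> j ` C"
  shows "\<exists>N d. d > 0 \<and> (\<forall>v\<in>L. norm v \<le> d \<longrightarrow> (\<exists>c\<in>C. norm c \<le> N \<and> j c = v))"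
proof -
  interpret j: bounded_linear j by (rule j)
  define D where "D N = closure (j ` (C \<inter> cball 0 N))" for N :: real
  have Dmono: "D N \<subseteq> D M" if "N \<le> M" for N M
    unfolding D_def using that by (intro closure_mono image_mono) auto
  have Dconv: "convex (D N)" for N
    unfolding D_def using C by (intro convex_closure convex_linear_image convex_Int) (auto intro: j.linear)
  \<comment> \<open>One index serves both as dilation factor and as norm bound. Since
    \<open>0 \<in> C\<close>, points of \<open>C\<close> can be shrunk, and these sets cover
    \<open>L\<close>.\<close>
  define F where "F m = {x \<in> L. (1 / real (Suc m)) *\<^sub>R x \<in> D (real (Suc m))}" for m
  have F: "closedin (top_of_set L) (F m)" for m
  proof -
    have "F m = L \<inter> (\<lambda>x. (1 / real (Suc m)) *\<^sub>R x) -` D (real (Suc m))" by (auto simp: F_def)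
    moreover have "closed ((\<lambda>x. (1 / real (Suc m)) *\<^sub>R x) -` D (real (Suc m)))"
      by (intro continuous_closed_vimage) (auto simp: D_def)
    ultimately show ?thesis by (auto simp: closedin_closed)
  qed
  have UF: "\<Union> (range F) = L"
  proof (intro equalityI subsetI)
    fix x assume x: "x \<in> L"
    obtain t c where t: "t > 0" "c \<in> C" "t *\<^sub>R x = j c" using abs[OF x] by blast
    obtain m where m: "real m \<ge> max (1 / t) (norm c)" using real_arch_simple by blast
    define M where "M = real (Suc m)"
    have M: "M * t \<ge> 1" "norm c \<le> M" "M > 0" using m t by (auto simp: M_def field_simps)
    have s: "0 \<le> 1 / (M * t)" "1 / (M * t) \<le> 1" using M t by (auto simp: field_simps)
    have "(1 / (M * t)) *\<^sub>R c \<in> C"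
      using convexD_alt[OF C(1) C(3) t(2) s] by simp
    moreover have "norm ((1 / (M * t)) *\<^sub>R c) \<le> 1 * M"
      unfolding norm_scaleR using M s t by (intro mult_mono) auto
    moreover have "j ((1 / (M * t)) *\<^sub>R c) = (1 / M) *\<^sub>R x"
      unfolding j.scaleR t(3)[symmetric] using t(1) by simp
    ultimately have "(1 / M) *\<^sub>R x \<in> j ` (C \<inter> cball 0 M)"
      by (intro image_eqI[of _ _ "(1 / (M * t)) *\<^sub>R c"]) auto
    then have "(1 / M) *\<^sub>R x \<in> D M" unfolding D_def by (rule subsetD[OF closure_subset])
    then show "x \<in> \<Union> (range F)" using x by (auto simp: F_def M_def)
  qed (auto simp: F_def)
  have "\<exists>m. top_of_set L interior_of F m \<noteq> {}"
  proof (rule ccontr)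
    assume "\<not> ?thesis"
    then have "top_of_set L interior_of \<Union> (range F) = {}"
      using F L(2) by (intro Baire_category_alt disjI1 completely_metrizable_space_closedin completely_metrizable_space_euclidean) auto
    moreover have "top_of_set L interior_of L = L"
      by (metis interior_of_topspace topspace_euclidean_subtopology)
    ultimately show False using UF L(1) subspace_0 by auto
  qed
  then obtain m x0 where "x0 \<in> top_of_set L interior_of F m" by blast
  then obtain T where T: "openin (top_of_set L) T" "T \<subseteq> F m" "x0 \<in> T" by (auto simp: interior_of_def)
  then obtain r where r: "r > 0" "\<And>y. y \<in> L \<Longrightarrow> dist y x0 < r \<Longrightarrow> y \<in> F m"
    unfolding openin_euclidean_subtopology_iff by blast
  have x0: "x0 \<in> L" using T by (auto simp: F_def)
  define M where "M = real (Suc m)"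
  have M: "M > 0" by (simp add: M_def)
  obtain t c1 where t: "t > 0" "c1 \<in> C" "t *\<^sub>R (- x0) = j c1" using abs[of "- x0"] x0 L(1) by (metis image_iff subspace_neg)
  define N where "N = max M (norm c1)"
  \<comment> \<open>Solves \<open>s / M = (1 - s) * t\<close>, so that the contributions of
    \<open>x0\<close> and of \<open>j c1\<close>, a negative multiple of \<open>x0\<close>,
    cancel.\<close>
  define s where "s = t * M / (1 + t * M)"
  have s: "0 < s" "s \<le> 1" "s / M = (1 - s) * t" 
  proof -
    have "t * M > 0" using M t by simp
    moreover from this have "1 - s = 1 / (1 + t * M)" by (simp add: s_def field_simps)
    ultimately show "0 < s" "s \<le> 1" "s / M = (1 - s) * t" using M by (simp_all add: s_def)
  qed
  define r' where "r' = r * s / M"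
  have r': "r' > 0" using r s M by (simp add: r'_def)
  have dense: "v \<in> D N" if v: "v \<in> L" "norm v < r'" for v
  proof -
    have "x0 + (M / s) *\<^sub>R v \<in> F m"
    proof (rule r(2))
      show "x0 + (M / s) *\<^sub>R v \<in> L" using L x0 v by (simp add: subspace_add subspace_scale)
      show "dist (x0 + (M / s) *\<^sub>R v) x0 < r" using v s M by (simp add: dist_norm r'_def field_simps)
    qed
    then have "(1 / M) *\<^sub>R (x0 + (M / s) *\<^sub>R v) \<in> D N"
      using Dmono[of M N] by (auto simp: F_def M_def N_def)
    moreover have "j c1 \<in> D N" unfolding D_def N_def using t closure_subset by fastforce
    ultimately have "s *\<^sub>R ((1 / M) *\<^sub>R (x0 + (M / s) *\<^sub>R v)) + (1 - s) *\<^sub>R j c1 \<in> D N"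
      using s by (intro convexD[OF Dconv]) auto
    also have "s *\<^sub>R ((1 / M) *\<^sub>R (x0 + (M / s) *\<^sub>R v)) + (1 - s) *\<^sub>R j c1 = (s / M) *\<^sub>R x0 + v - ((1 - s) * t) *\<^sub>R x0"
      unfolding t(3)[symmetric] using s M by (simp add: scaleR_add_right)
    also have "\<dots> = v" unfolding s(3) by simp
    finally show ?thesis .
  qed
  show ?thesis
  proof (rule exI[of _ N], rule exI[of _ "r' / 4"], intro conjI ballI impI)
    fix v assume v: "v \<in> L" "norm v \<le> r' / 4"
    \<comment> \<open>The lemma on dense images halves its argument, so it is applied to twice
      \<open>v\<close>, whose norm is at most \<open>r' / 2\<close>.\<close>
    have "\<exists>c\<in>C. norm c \<le> N \<and> j c = (1/2) *\<^sub>R (2 *\<^sub>R v)"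
      using v L(1) r' by (intro convex_image_dense_open[OF C j L(1,3) r' dense[unfolded D_def]]) (auto simp: subspace_scale)
    then show "\<exists>c\<in>C. norm c \<le> N \<and> j c = v" by simp
  qed (use r' in simp)
qed

text \<open>The base point may be any point of the affine hull, not only of \<open>D\<close>. Both
  parts follow from the equality of the spans of \<open>D\<close> shifted by \<open>- a\<close> and
  of the differences of \<open>D\<close>.\<close>

lemma affine_hull_direction:
  fixes D :: "'b::real_vector set"
  assumes a: "a \<in> affine hull D"
  shows "affine hull D = (\<lambda>x. a + x) ` (affine hull (set_diff D D))" "subspace (affine hull (set_diff D D))"
proof -
  have ne: "D \<noteq> {}" using a by auto
  have "0 \<in> set_diff D D" using ne by (force simp: set_diff_def)
  then have sp: "affine hull (set_diff D D) = span (set_diff D D)"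
    by (simp add: affine_hull_span_0 hull_inc)
  have "span ((\<lambda>x. - a + x) ` D) = span (set_diff D D)"
  proof (rule antisym)
    obtain d where d: "d \<in> D" using ne by auto
    have "(\<lambda>x. - d + x) ` D \<subseteq> set_diff D D" using d by (auto simp: set_diff_def)
    then have "span ((\<lambda>x. - d + x) ` D) \<subseteq> span (set_diff D D)" by (rule span_mono)
    then have "a - d \<in> span (set_diff D D)"
      using a affine_hull_span_gen[of d D] d by (auto simp: hull_inc)
    have "- a + x \<in> span (set_diff D D)" if "x \<in> D" for x
    proof -
      have "x - d \<in> span (set_diff D D)" using that d by (intro span_base) (auto simp: set_diff_def)
      from span_diff[OF this \<open>a - d \<in> _\<close>] show ?thesis by (simp add: algebra_simps)
    qed
    then show "span ((\<lambda>x. - a + x) ` D) \<subseteq> span (set_diff D D)"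
      by (intro span_minimal) auto
    have "x - y \<in> span ((\<lambda>x. - a + x) ` D)" if "x \<in> D" "y \<in> D" for x y
      using span_diff[OF span_base span_base, of "- a + x" "(\<lambda>x. - a + x) ` D" "- a + y"] that
      by auto
    then show "span (set_diff D D) \<subseteq> span ((\<lambda>x. - a + x) ` D)"
      by (intro span_minimal) (auto simp: set_diff_def)
  qed
  then show "affine hull D = (\<lambda>x. a + x) ` (affine hull (set_diff D D))" "subspace (affine hull (set_diff D D))"
    using affine_hull_span_gen[OF a] sp by auto
qed

text \<open>Nonemptiness matters: for empty \<open>D\<close> the condition in \<open>icr\<close> is
  vacuous and \<open>icr D\<close> is the whole space.\<close>

lemma icr_subset: "D \<noteq> {} \<Longrightarrow> icr D \<subseteq> D"
proof
  fix u assume ne: "D \<noteq> {}" and u: "u \<in> icr D"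
  have "0 \<in> set_diff D D" using ne by (force simp: set_diff_def)
  then have "0 \<in> affine hull (set_diff D D)" by (simp add: hull_inc)
  then show "u \<in> D" using u unfolding icr_def by force
qed

text \<open>Translation by a preimage of \<open>u\<close> in \<open>C\<close> turns the affine hull
  into a closed subspace, and membership in \<open>icr\<close> gives the absorption required by
  \<open>convex_absorbing_image_open\<close>.\<close>

theorem icr_convex_image_open:
  fixes j :: "'c::banach \<Rightarrow> 'e::banach"
  assumes C: "convex C" "closed C" "C \<noteq> {}" and j: "bounded_linear j"
    and cl: "closed (affine hull (j ` C))" and u: "u \<in> icr (j ` C)"
  shows "\<exists>N d. d > 0 \<and> (\<forall>v\<in>affine hull (j ` C). norm (v - u) \<le> d \<longrightarrow> (\<exists>c\<in>C. norm c \<le> N \<and> j c = v))"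
proof -
  interpret j: bounded_linear j by (rule j)
  let ?D = "j ` C" and ?L = "affine hull (set_diff (j ` C) (j ` C))"
  obtain c0 where c0: "c0 \<in> C" "u = j c0" using icr_subset[of ?D] C u by blast
  have uD: "u \<in> affine hull ?D" using c0 by (simp add: hull_inc)
  note dir = affine_hull_direction[OF uD]
  let ?C = "(\<lambda>c. c - c0) ` C"
  have C': "convex ?C" "closed ?C" "0 \<in> ?C"
    using C c0 by (auto intro: closed_translation_subtract)
  have "?L = (\<lambda>x. - u + x) ` (affine hull ?D)" by (subst dir(1)) (simp add: image_image)
  then have clL: "closed ?L" using closed_translation[OF cl, of "- u"] by (simp only:)
  have jL: "j ` ?C \<subseteq> ?L"
  proof clarsimp
    fix c assume "c \<in> C"
    then have "j c - j c0 \<in> set_diff ?D ?D" using c0 by (auto simp: set_diff_def)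
    then show "j (c - c0) \<in> ?L" by (simp add: j.diff hull_inc)
  qed
  have "\<exists>t>0. t *\<^sub>R x \<in> j ` ?C" if x: "x \<in> ?L" for x
  proof -
    obtain d where d: "d > 0" "\<And>l. l \<in> {0..d} \<Longrightarrow> u + l *\<^sub>R x \<in> ?D"
      using u x unfolding icr_def by blast
    obtain c where "c \<in> C" "u + d *\<^sub>R x = j c" using d(2)[of d] d(1) by auto
    then have "d *\<^sub>R x = j (c - c0)" using c0 by (simp add: j.diff algebra_simps)
    then show ?thesis using d \<open>c \<in> C\<close> by blast
  qed
  from convex_absorbing_image_open[OF C' j dir(2) clL jL this]
  obtain N d where Nd: "d > 0" "\<And>v. v \<in> ?L \<Longrightarrow> norm v \<le> d \<Longrightarrow> \<exists>c\<in>?C. norm c \<le> N \<and> j c = v" by blast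
  show ?thesis
  proof (rule exI[of _ "N + norm c0"], rule exI[of _ d], intro conjI ballI impI)
    fix v assume v: "v \<in> affine hull ?D" "norm (v - u) \<le> d"
    have "v - u \<in> ?L" using v(1) by (subst (asm) dir(1)) auto
    from Nd(2)[OF this v(2)] obtain c where c: "c \<in> C" "norm (c - c0) \<le> N" "j (c - c0) = v - u" by auto
    have "norm c \<le> N + norm c0" using c(2) norm_triangle_sub[of c c0] by linarith
    moreover have "j c = v" using c(3) c0 by (simp add: j.diff)
    ultimately show "\<exists>c\<in>C. norm c \<le> N + norm c0 \<and> j c = v" using c(1) by blast
  qed (rule Nd)
qed

lemma rel_interior_subset_icr: "rel_interior D \<subseteq> icr (D :: 'b::real_normed_vector set)"
proof
  fix u assume "u \<in> rel_interior D"
  then obtain e where e: "e > 0" "u \<in> D" "ball u e \<inter> affine hull D \<subseteq> D"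
    unfolding mem_rel_interior_ball by blast
  have u: "u \<in> affine hull D" using e by (simp add: hull_inc)
  note dir = affine_hull_direction[OF u]
  show "u \<in> icr D"
    unfolding icr_def
  proof (intro CollectI ballI)
    fix x assume x: "x \<in> affine hull (set_diff D D)"
    show "\<exists>d>0. \<forall>l\<in>{0..d}. u + l *\<^sub>R x \<in> D"
    proof (intro exI[of _ "e / (1 + norm x)"] conjI ballI)
      show "0 < e / (1 + norm x)" using e by (simp add: add_pos_nonneg)
      fix l assume l: "l \<in> {0..e / (1 + norm x)}"
      have "u + l *\<^sub>R x \<in> affine hull D"
        by (subst dir(1)) (use x dir(2) subspace_scale in blast)
      moreover have "norm (l *\<^sub>R x) < e"
      proof -
        have "l * (1 + norm x) \<le> e" using l by (simp add: pos_le_divide_eq add_pos_nonneg)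
        then show ?thesis using l e by (cases "l = 0") (auto simp: distrib_left)
      qed
      ultimately show "u + l *\<^sub>R x \<in> D" using e by (intro set_mp[OF e(3)]) (auto simp: dist_norm)
    qed
  qed
qed

text \<open>The algebraic interior is upgraded to the topological one by
  \<open>icr_convex_image_open\<close>; the converse inclusion holds for every set.\<close>

lemma ic_convex_image_eq_ri:
  fixes j :: "'c::banach \<Rightarrow> 'e::banach"
  assumes C: "convex C" "closed C" "C \<noteq> {}" and j: "bounded_linear j"
  shows "ic (j ` C) = ri (j ` C)"
proof (cases "closed (affine hull (j ` C))")
  case True
  have "u \<in> rel_interior (j ` C)" if u: "u \<in> icr (j ` C)" for u
  proof -
    obtain N d where "d > 0" and d: "\<And>v. v \<in> affine hull (j ` C) \<Longrightarrow> norm (v - u) \<le> d \<Longrightarrow> \<exists>c\<in>C. norm c \<le> N \<and> j c = v"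
      using icr_convex_image_open[OF C j True u] by blast
    moreover have "u \<in> j ` C" using icr_subset[of "j ` C"] C u by blast
    ultimately show ?thesis unfolding mem_rel_interior_ball
      by (intro conjI exI[of _ d]) (fastforce simp: dist_norm norm_minus_commute)+
  qed
  then show ?thesis using rel_interior_subset_icr True by (auto simp: ic_def ri_def)
qed (simp add: ic_def ri_def)

section \<open>Strongly representing convex sets\<close>

text \<open>The canonical embedding of the space into its bidual.\<close>

definition dual_eval :: "'a::real_normed_vector \<Rightarrow> 'a bidual" where
  "dual_eval x = Blinfun (\<lambda>f. blinfun_apply f x)"

lemma dual_eval_apply [simp]: "dual_eval x f = f x"
  unfolding dual_eval_def
  by (subst bounded_linear_Blinfun_apply) (auto intro: blinfun.bounded_linear_left)

text \<open>Says that the conjugate of the function with lower boundary \<open>E\<close> is at most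
  \<open>b\<close> at \<open>(x', x'')\<close>; with real \<open>b\<close>, the duality arguments
  stay free of extended reals.\<close>

definition conj_le :: "('a::real_normed_vector \<times> 'a dual \<times> real) set \<Rightarrow> 'a dual \<Rightarrow> 'a bidual \<Rightarrow> real \<Rightarrow> bool" where
  "conj_le E x' x'' b \<longleftrightarrow> (\<forall>(y, y', r)\<in>E. x' y + x'' y' - r \<le> b)"

text \<open>Strong representability of a convex function, expressed through its real epigraph or any
  other convex set \<open>E\<close> whose lower boundary is the function.\<close>

definition strong_set :: "('a::real_normed_vector \<times> 'a dual \<times> real) set \<Rightarrow> bool" where
  "strong_set E \<longleftrightarrow> convex E \<and> (\<forall>(x, x', r)\<in>E. blinfun_apply x' x \<le> r) \<and>
     (\<forall>x' x'' b. conj_le E x' x'' b \<longrightarrow> x'' x' \<le> b)"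

text \<open>Collects the points of the primal space at which the conjugate touches the coupling: for
  a strong set the required upper bound is also a lower bound.\<close>

definition assoc_op :: "('a::real_normed_vector \<times> 'a dual \<times> real) set \<Rightarrow> 'a \<Rightarrow> 'a dual set" where
  "assoc_op E x = {x'. conj_le E x' (dual_eval x) (x' x)}"

lemma strong_setD:
  assumes "strong_set E"
  shows "convex E" "(x, x', r) \<in> E \<Longrightarrow> blinfun_apply x' x \<le> r" "conj_le E x' x'' b \<Longrightarrow> x'' x' \<le> b"
  using assms unfolding strong_set_def by auto

lemma strong_set_nonempty: "strong_set E \<Longrightarrow> E \<noteq> {}"
  using strong_setD(3)[of E 0 0 "-1"] by (auto simp: conj_le_def)

section \<open>Tangent inequalities at points of contact with the coupling\<close>

text \<open>First-order comparison at \<open>t = 0\<close>: the left side is a quadratic along a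
  segment, the right side a chord with the same value at \<open>t = 0\<close>, so the slopes are
  ordered. It is used wherever a convex function touches the coupling.\<close>

lemma convex_tangent_le:
  fixes \<alpha> \<beta> \<gamma> \<kappa> :: real
  assumes "\<And>t. 0 < t \<Longrightarrow> t < 1 \<Longrightarrow> (1 - t)\<^sup>2 * \<alpha> + t * (1 - t) * \<gamma> + t\<^sup>2 * \<kappa> \<le> (1 - t) * \<alpha> + t * \<beta>"
  shows "\<gamma> \<le> \<alpha> + \<beta>"
proof (rule ccontr)
  assume neg: "\<not> ?thesis"
  define e where "e = \<gamma> - \<alpha> - \<beta>"
  have e: "e > 0" using neg by (simp add: e_def)
  define c where "c = \<bar>\<gamma> - \<alpha> - \<kappa>\<bar> + 1"
  have c: "c > 0" "\<gamma> - \<alpha> - \<kappa> < c" by (auto simp: c_def)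
  define t where "t = min (1/2) (e / c)"
  have t: "0 < t" "t < 1" "t * c \<le> e" using e c by (auto simp: t_def min_def field_simps)
  have "t * ((1 - t) * (\<gamma> - \<alpha>) + t * \<kappa>) \<le> t * \<beta>"
    using assms[OF t(1,2)] by (simp add: algebra_simps power2_eq_square)
  then have "(1 - t) * (\<gamma> - \<alpha>) + t * \<kappa> \<le> \<beta>" using t by simp
  then have "e \<le> t * (\<gamma> - \<alpha> - \<kappa>)" by (simp add: e_def algebra_simps)
  also have "\<dots> < t * c" using t c by simp
  finally show False using t by simp
qed

text \<open>The conjugate is convex, lies above the coupling and touches it at
  \<open>(x', x'')\<close>, so the tangent of the coupling there is a minorant of the
  conjugate.\<close>

lemma conj_tangent:
  assumes E: "strong_set E" and x: "conj_le E x' x'' (x'' x')" and y: "conj_le E y' y'' b"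
  shows "x'' y' + y'' x' \<le> x'' x' + b"
proof (rule convex_tangent_le)
  fix t :: real assume t: "0 < t" "t < 1"
  have "conj_le E ((1 - t) *\<^sub>R x' + t *\<^sub>R y') ((1 - t) *\<^sub>R x'' + t *\<^sub>R y'') ((1 - t) * x'' x' + t * b)"
    unfolding conj_le_def
  proof clarify
    fix v v' r assume v: "(v, v', r) \<in> E"
    have "(1 - t) * (x' v + x'' v' - r) \<le> (1 - t) * x'' x'" "t * (y' v + y'' v' - r) \<le> t * b"
      using x y v t by (auto simp: conj_le_def intro!: mult_left_mono)
    then show "((1 - t) *\<^sub>R x' + t *\<^sub>R y') v + ((1 - t) *\<^sub>R x'' + t *\<^sub>R y'') v' - r \<le> (1 - t) * x'' x' + t * b"
      by (simp add: blinfun.bilinear_simps algebra_simps)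
  qed
  from strong_setD(3)[OF E this]
  show "(1 - t)\<^sup>2 * x'' x' + t * (1 - t) * (x'' y' + y'' x') + t\<^sup>2 * y'' y' \<le> (1 - t) * x'' x' + t * b"
    by (simp add: blinfun.bilinear_simps algebra_simps power2_eq_square)
qed

lemma assoc_op_monotone:
  assumes E: "strong_set E" and x: "x' \<in> assoc_op E x" and y: "y' \<in> assoc_op E y"
  shows "(x' - y') (x - y) \<ge> 0"
  using conj_tangent[OF E, of x' "dual_eval x" y' "dual_eval y" "y' y"] x y
  by (simp add: assoc_op_def blinfun.bilinear_simps)

section \<open>Squared norms and Fenchel duality\<close>

lemma power2_norm_convex:
  fixes a b :: "'v::real_normed_vector"
  assumes "0 \<le> t" "t \<le> 1"
  shows "(norm ((1 - t) *\<^sub>R a + t *\<^sub>R b))\<^sup>2 \<le> (1 - t) * (norm a)\<^sup>2 + t * (norm b)\<^sup>2"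
proof -
  have "norm ((1 - t) *\<^sub>R a + t *\<^sub>R b) \<le> (1 - t) * norm a + t * norm b"
    using norm_triangle_ineq[of "(1 - t) *\<^sub>R a" "t *\<^sub>R b"] assms by simp
  then have "(norm ((1 - t) *\<^sub>R a + t *\<^sub>R b))\<^sup>2 \<le> ((1 - t) * norm a + t * norm b)\<^sup>2"
    by (intro power_mono) auto
  also have "\<dots> = (1 - t) * (norm a)\<^sup>2 + t * (norm b)\<^sup>2 - t * (1 - t) * (norm a - norm b)\<^sup>2"
    by (simp add: algebra_simps power2_eq_square)
  also have "\<dots> \<le> (1 - t) * (norm a)\<^sup>2 + t * (norm b)\<^sup>2" using assms by simp
  finally show ?thesis .
qed

lemma blinfun_almost_attains:
  fixes f :: "'v::real_normed_vector \<Rightarrow>\<^sub>L real"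
  assumes "e > 0"
  shows "\<exists>u. norm u \<le> 1 \<and> norm f - e \<le> f u"
proof (cases "norm f \<le> e")
  case True
  then show ?thesis by (intro exI[of _ 0]) (simp add: blinfun.zero_right)
next
  case False
  have "\<exists>u. norm (f u) > (norm f - e) * norm u"
  proof (rule ccontr)
    assume "\<not> ?thesis"
    then have "norm f \<le> norm f - e" using False by (intro norm_blinfun_bound) (auto simp: not_less)
    then show False using assms by simp
  qed
  then obtain u where u: "norm (f u) > (norm f - e) * norm u" by blast
  then have u0: "norm u > 0" using False by (cases "u = 0") (auto simp: blinfun.zero_right)
  define v where "v = (sgn (f u) / norm u) *\<^sub>R u"
  have "norm v \<le> 1" using u0 by (auto simp: v_def abs_sgn_eq)
  moreover have "f v = norm (f u) / norm u"
    by (simp add: v_def blinfun.scaleR_right abs_sgn mult.commute)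
  then have "norm f - e \<le> f v" using u u0 by (simp add: pos_le_divide_eq)
  ultimately show ?thesis by blast
qed

text \<open>Near attainment in the conjugate of the weighted half square: follow a direction in
  which \<open>f\<close> almost attains its norm, up to length \<open>norm f / l\<close>.\<close>

lemma half_square_conjugate:
  fixes f :: "'v::real_normed_vector \<Rightarrow>\<^sub>L real"
  assumes l: "l > 0" and e: "e > 0"
  shows "\<exists>w. l / 2 * (norm w)\<^sup>2 - f w \<le> e - (norm f)\<^sup>2 / (2 * l)"
proof -
  \<comment> \<open>Keeps the loss \<open>norm f / l * d\<close> below \<open>e\<close>; the summand
    1 covers \<open>f = 0\<close>.\<close>
  define d where "d = e * l / (norm f + 1)"
  have d: "d > 0" using l e by (simp add: d_def add_nonneg_pos)
  obtain u where u: "norm u \<le> 1" "norm f - d \<le> f u" using blinfun_almost_attains[OF d] by blast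
  define w where "w = (norm f / l) *\<^sub>R u"
  have "norm w \<le> norm f / l" using u l by (simp add: w_def mult_left_le divide_right_mono)
  then have "(norm w)\<^sup>2 \<le> (norm f / l)\<^sup>2" by (intro power_mono) auto
  then have "l / 2 * (norm w)\<^sup>2 \<le> l / 2 * (norm f / l)\<^sup>2" using l by (intro mult_left_mono) auto
  also have "\<dots> = (norm f)\<^sup>2 / (2 * l)" using l by (simp add: power2_eq_square)
  finally have 1: "l / 2 * (norm w)\<^sup>2 \<le> (norm f)\<^sup>2 / (2 * l)" .
  have "norm f / l * (norm f - d) \<le> norm f / l * f u" using u l by (intro mult_left_mono) auto
  then have 2: "norm f / l * (norm f - d) \<le> f w" by (simp add: w_def blinfun.scaleR_right)
  have "norm f / l * d = e * (norm f / (norm f + 1))" using l by (simp add: d_def)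
  also have "\<dots> \<le> e * 1" using e by (intro mult_left_mono) (auto simp: divide_le_eq_1 add_nonneg_pos)
  finally have "norm f / l * d \<le> e" by simp
  moreover have "norm f / l * (norm f - d) = (norm f)\<^sup>2 / (2 * l) + (norm f)\<^sup>2 / (2 * l) - norm f / l * d"
    using l by (simp add: field_simps power2_eq_square)
  ultimately show ?thesis using 1 2 by (intro exI[of _ w]) linarith
qed

lemma blinfun_prod_split:
  fixes f :: "('v::real_normed_vector \<times> 'w::real_normed_vector) \<Rightarrow>\<^sub>L real"
  obtains a :: "'v \<Rightarrow>\<^sub>L real" and b :: "'w \<Rightarrow>\<^sub>L real" where "\<And>u v. blinfun_apply f (u, v) = a u + b v"
proof
  have 1: "bounded_linear (\<lambda>u. blinfun_apply f (u, 0))" "bounded_linear (\<lambda>v. blinfun_apply f (0, v))"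
    by (intro bounded_linear_compose[OF blinfun.bounded_linear_right] bounded_linear_Pair
        bounded_linear_ident bounded_linear_zero)+
  show "blinfun_apply f (u, v) = Blinfun (\<lambda>u. blinfun_apply f (u, 0)) u + Blinfun (\<lambda>v. blinfun_apply f (0, v)) v" for u v
    using blinfun.add_right[of f "(u, 0)" "(0, v)"] by (simp add: 1 bounded_linear_Blinfun_apply)
qed

lemma weighted_young:
  fixes a b l :: real
  assumes "l > 0"
  shows "a * b \<le> l / 2 * a\<^sup>2 + 1 / (2 * l) * b\<^sup>2"
proof -
  have "0 \<le> (l * a - b)\<^sup>2 / (2 * l)" using assms by simp
  also have "\<dots> = l / 2 * a\<^sup>2 + 1 / (2 * l) * b\<^sup>2 - a * b" using assms by (simp add: field_simps power2_eq_square)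
  finally show ?thesis by simp
qed

lemma blinfun_ge: "- (norm f * norm x) \<le> blinfun_apply f x" for f :: "'v::real_normed_vector \<Rightarrow>\<^sub>L real"
  using norm_blinfun[of f x] by (simp add: abs_le_iff)

lemma blinfun_le: "blinfun_apply f x \<le> norm f * norm x" for f :: "'v::real_normed_vector \<Rightarrow>\<^sub>L real"
  using norm_blinfun[of f x] by (simp add: abs_le_iff)

text \<open>Fenchel duality between \<open>E\<close> and the weighted squared norms: strongness says that the dual
  value is nonpositive.\<close>

lemma strong_set_near_minimum:
  fixes E :: "('a::real_normed_vector \<times> 'a dual \<times> real) set"
  assumes E: "strong_set E" and l: "l > 0" and e: "e > 0"
  shows "\<exists>(x, x', r)\<in>E. r - (blinfun_apply x0' x + blinfun_apply x' x0 - blinfun_apply x0' x0)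
           + l / 2 * (norm (x - x0))\<^sup>2 + 1 / (2 * l) * (norm (x' - x0'))\<^sup>2 < e"
proof (rule ccontr)
  assume "\<not> ?thesis"
  then have H: "\<And>x x' r. (x, x', r) \<in> E \<Longrightarrow> e \<le> r - (blinfun_apply x0' x + blinfun_apply x' x0 - blinfun_apply x0' x0)
           + l / 2 * (norm (x - x0))\<^sup>2 + 1 / (2 * l) * (norm (x' - x0'))\<^sup>2" by (force simp: not_less)
  let ?C = "E \<times> (UNIV :: ('a \<times> 'a dual) set)"
  \<comment> \<open>The two norms get their own copies of the variables; the constraint
    \<open>j = 0\<close> identifies these with the displacements from
    \<open>(x0, x0')\<close>.\<close>
  define j :: "('a \<times> 'a dual \<times> real) \<times> 'a \<times> 'a dual \<Rightarrow> 'a \<times> 'a dual" where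
    "j = (\<lambda>((x, x', r), w, w'). (x - x0 - w, x' - x0' - w'))"
  define k :: "('a \<times> 'a dual \<times> real) \<times> 'a \<times> 'a dual \<Rightarrow> real" where
    "k = (\<lambda>((x, x', r), w, w'). r - (blinfun_apply x0' x + blinfun_apply x' x0)
           + (l / 2 * (norm w)\<^sup>2 + 1 / (2 * l) * (norm w')\<^sup>2))"
  obtain z1 z1' r1 where z1: "(z1, z1', r1) \<in> E" using strong_set_nonempty[OF E] by auto
  have sq: "p * (norm ((1 - t) *\<^sub>R a + t *\<^sub>R b))\<^sup>2 \<le> (1 - t) * (p * (norm a)\<^sup>2) + t * (p * (norm b)\<^sup>2)"
    if "0 < t" "t < 1" "p \<ge> 0" for t p and a b :: "'v::real_normed_vector"
    using mult_left_mono[OF power2_norm_convex[of t a b], of p] that by (simp add: algebra_simps)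
  have "\<exists>f :: ('a \<times> 'a dual) \<Rightarrow>\<^sub>L real. \<forall>c\<in>?C. e - x0' x0 \<le> blinfun_apply f (j c) + k c"
  proof (rule qualified_constraint_multiplier[where L = UNIV and d = 1])
    show "?C \<noteq> {}" using z1 by auto
    show "j ((1 - t) *\<^sub>R x + t *\<^sub>R y) = (1 - t) *\<^sub>R j x + t *\<^sub>R j y" for x y t
      unfolding j_def by (auto split: prod.splits simp: algebra_simps)
    show "convex_on ?C k"
    proof (rule convex_onI)
      show "convex ?C" using strong_setD(1)[OF E] by (intro convex_Times) auto
      fix t :: real and x y :: "('a \<times> 'a dual \<times> real) \<times> 'a \<times> 'a dual" assume t: "0 < t" "t < 1"
      obtain x1 x2 x3 x4 x5 where x: "x = ((x1, x2, x3), (x4, x5))" by (metis surj_pair)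
      obtain y1 y2 y3 y4 y5 where y: "y = ((y1, y2, y3), (y4, y5))" by (metis surj_pair)
      let ?A = "\<lambda>u u' r. r - (blinfun_apply x0' u + blinfun_apply u' x0)"
        and ?p = "l / 2" and ?q = "1 / (2 * l)"
      have A: "?A ((1 - t) *\<^sub>R x1 + t *\<^sub>R y1) ((1 - t) *\<^sub>R x2 + t *\<^sub>R y2) ((1 - t) * x3 + t * y3)
          = (1 - t) * ?A x1 x2 x3 + t * ?A y1 y2 y3"
        by (simp add: blinfun.bilinear_simps algebra_simps)
      have "k ((1 - t) *\<^sub>R x + t *\<^sub>R y)
          = ?A ((1 - t) *\<^sub>R x1 + t *\<^sub>R y1) ((1 - t) *\<^sub>R x2 + t *\<^sub>R y2) ((1 - t) * x3 + t * y3)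
            + (?p * (norm ((1 - t) *\<^sub>R x4 + t *\<^sub>R y4))\<^sup>2 + ?q * (norm ((1 - t) *\<^sub>R x5 + t *\<^sub>R y5))\<^sup>2)"
        by (simp add: k_def x y)
      also have "\<dots> \<le> ((1 - t) * ?A x1 x2 x3 + t * ?A y1 y2 y3)
            + (((1 - t) * (?p * (norm x4)\<^sup>2) + t * (?p * (norm y4)\<^sup>2))
               + ((1 - t) * (?q * (norm x5)\<^sup>2) + t * (?q * (norm y5)\<^sup>2)))"
        unfolding A using l by (intro add_left_mono add_mono sq t) auto
      also have "\<dots> = (1 - t) * k x + t * k y"
        unfolding k_def x y prod.case by (simp only: distrib_left add_ac)
      finally show "k ((1 - t) *\<^sub>R x + t *\<^sub>R y) \<le> (1 - t) * k x + t * k y" .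
    qed
    \<comment> \<open>The copies absorb any perturbation \<open>v\<close> while the point of
      \<open>E\<close> stays fixed, so the qualification holds on the whole unit ball.\<close>
    show "\<exists>c\<in>?C. j c = v \<and> k c \<le> r1 - (x0' z1 + z1' x0) + (l / 2 * (norm (z1 - x0) + 1)\<^sup>2 + 1 / (2 * l) * (norm (z1' - x0') + 1)\<^sup>2)"
      if "norm v \<le> 1" for v
    proof (intro bexI[of _ "((z1, z1', r1), z1 - x0 - fst v, z1' - x0' - snd v)"] conjI)
      have n: "norm (fst v) \<le> 1" "norm (snd v) \<le> 1"
        using that norm_fst_le[of "fst v" "snd v"] norm_snd_le[of "snd v" "fst v"] by auto
      have "norm (z1 - x0 - fst v) \<le> norm (z1 - x0) + 1" "norm (z1' - x0' - snd v) \<le> norm (z1' - x0') + 1"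
        using norm_triangle_ineq4[of "z1 - x0" "fst v"] norm_triangle_ineq4[of "z1' - x0'" "snd v"] n by linarith+
      then have "(norm (z1 - x0 - fst v))\<^sup>2 \<le> (norm (z1 - x0) + 1)\<^sup>2"
        "(norm (z1' - x0' - snd v))\<^sup>2 \<le> (norm (z1' - x0') + 1)\<^sup>2"
        by (auto intro!: power_mono)
      then have "l / 2 * (norm (z1 - x0 - fst v))\<^sup>2 \<le> l / 2 * (norm (z1 - x0) + 1)\<^sup>2"
        "1 / (2 * l) * (norm (z1' - x0' - snd v))\<^sup>2 \<le> 1 / (2 * l) * (norm (z1' - x0') + 1)\<^sup>2"
        using l by (auto intro!: mult_left_mono divide_right_mono)
      then show "k ((z1, z1', r1), z1 - x0 - fst v, z1' - x0' - snd v) \<le> r1 - (x0' z1 + z1' x0) + (l / 2 * (norm (z1 - x0) + 1)\<^sup>2 + 1 / (2 * l) * (norm (z1' - x0') + 1)\<^sup>2)"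
        unfolding k_def by auto
    qed (use z1 in \<open>auto simp: j_def\<close>)
    show "e - x0' x0 \<le> k c" if "c \<in> ?C" "j c = 0" for c
      using that H unfolding j_def k_def by (fastforce simp: zero_prod_def)
  qed auto
  then obtain f where f: "\<And>c. c \<in> ?C \<Longrightarrow> e - x0' x0 \<le> blinfun_apply f (j c) + k c" by blast
  obtain a :: "'a dual" and b :: "'a bidual" where ab: "\<And>u v. blinfun_apply f (u, v) = a u + b v"
    using blinfun_prod_split[of f] by blast
  obtain w where w: "l / 2 * (norm w)\<^sup>2 - a w \<le> e / 4 - (norm a)\<^sup>2 / (2 * l)"
    using half_square_conjugate[OF l, of "e / 4"] e by auto
  obtain w' where "(1 / l) / 2 * (norm w')\<^sup>2 - b w' \<le> e / 4 - (norm b)\<^sup>2 / (2 * (1 / l))"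
    using half_square_conjugate[of "1 / l" "e / 4"] e l by auto
  then have w': "1 / (2 * l) * (norm w')\<^sup>2 - b w' \<le> e / 4 - l / 2 * (norm b)\<^sup>2" by (simp add: algebra_simps)
  \<comment> \<open>Inserting the near-minimizers \<open>w\<close> and \<open>w'\<close> leaves a
    bound for the conjugate at the point shifted by the multiplier. There strongness cancels all
    terms of the coupling except \<open>b a\<close>, and the bound left for it contradicts Young's
    inequality.\<close>
  have "conj_le E (x0' - a) (dual_eval x0 - b) (x0' x0 - a x0 - b x0' - e / 2 - (norm a)\<^sup>2 / (2 * l) - l / 2 * (norm b)\<^sup>2)"
    unfolding conj_le_def
  proof clarify
    fix x x' r assume x: "(x, x', r) \<in> E"
    have "e - x0' x0 \<le> a (x - x0 - w) + b (x' - x0' - w') + (r - (x0' x + x' x0)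
           + (l / 2 * (norm w)\<^sup>2 + 1 / (2 * l) * (norm w')\<^sup>2))"
      using f[of "((x, x', r), w, w')"] x by (simp add: j_def k_def ab)
    then show "(x0' - a) x + (dual_eval x0 - b) x' - r \<le> x0' x0 - a x0 - b x0' - e / 2 - (norm a)\<^sup>2 / (2 * l) - l / 2 * (norm b)\<^sup>2"
      using w w' by (simp add: blinfun.bilinear_simps)
  qed
  from strong_setD(3)[OF E this]
  have "b a \<le> - e / 2 - (norm a)\<^sup>2 / (2 * l) - l / 2 * (norm b)\<^sup>2" by (simp add: blinfun.bilinear_simps)
  moreover have "- (norm b * norm a) \<le> b a" by (rule blinfun_ge)
  moreover have "norm b * norm a \<le> l / 2 * (norm b)\<^sup>2 + 1 / (2 * l) * (norm a)\<^sup>2" by (rule weighted_young[OF l])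
  ultimately show False using e by simp
qed

section \<open>Approximation by the associated operator\<close>

text \<open>Near-minimality around \<open>(x0, x0')\<close> quarters the bound on the gap between
  height and coupling. The distance moved is controlled through the midpoint of old and new point,
  which lies in \<open>E\<close> and hence above the coupling.\<close>

lemma strong_set_near_graph_step:
  assumes E: "strong_set E" and x0: "(x0, x0', r0) \<in> E" "r0 - x0' x0 \<le> e\<^sup>2" and e: "e > 0"
  shows "\<exists>(x, x', r)\<in>E. r - blinfun_apply x' x \<le> (e / 2)\<^sup>2 \<and> norm (x - x0) \<le> 3 * e \<and> norm (x' - x0') \<le> 3 * e"
proof -
  obtain x x' r where x: "(x, x', r) \<in> E"
    and min: "r - (x0' x + x' x0 - x0' x0) + 1 / 2 * (norm (x - x0))\<^sup>2 + 1 / (2 * 1) * (norm (x' - x0'))\<^sup>2 < e\<^sup>2 / 4"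
    using strong_set_near_minimum[OF E, of 1 "e\<^sup>2 / 4" x0' x0] e by auto
  define q where "q = (x' - x0') (x - x0)"
  have q: "x0' x + x' x0 - x0' x0 = x' x - q" by (simp add: q_def blinfun.bilinear_simps)
  have "- (norm (x' - x0') * norm (x - x0)) \<le> q" unfolding q_def by (rule blinfun_ge)
  moreover have "norm (x' - x0') * norm (x - x0) \<le> 1 / 2 * (norm (x' - x0'))\<^sup>2 + 1 / (2 * 1) * (norm (x - x0))\<^sup>2"
    by (rule weighted_young) simp
  ultimately have 1: "r - x' x \<le> e\<^sup>2 / 4" using min unfolding q by simp
  have rx: "x' x \<le> r" by (rule strong_setD(2)[OF E x])
  have "(1/2) *\<^sub>R (x, x', r) + (1/2) *\<^sub>R (x0, x0', r0) \<in> E"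
    using strong_setD(1)[OF E] x x0 by (intro convexD) auto
  then have "((1/2) *\<^sub>R x' + (1/2) *\<^sub>R x0') ((1/2) *\<^sub>R x + (1/2) *\<^sub>R x0) \<le> r / 2 + r0 / 2"
    by (intro strong_setD(2)[OF E]) simp
  then have "x' x + x' x0 + x0' x + x0' x0 \<le> 2 * r + 2 * r0" by (simp add: blinfun.bilinear_simps field_simps)
  then have "- q \<le> 2 * (r - x' x) + 2 * (r0 - x0' x0)" using q by simp
  then have "- q \<le> 5 / 2 * e\<^sup>2" using 1 x0(2) by simp
  then have *: "(norm (x - x0))\<^sup>2 + (norm (x' - x0'))\<^sup>2 \<le> 11/2 * e\<^sup>2" using min rx unfolding q by simp
  have "11/2 * e\<^sup>2 \<le> (3 * e)\<^sup>2" by (simp add: power_mult_distrib)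
  then have "(norm (x - x0))\<^sup>2 \<le> (3 * e)\<^sup>2" "(norm (x' - x0'))\<^sup>2 \<le> (3 * e)\<^sup>2"
    using * zero_le_power2[of "norm (x - x0)"] zero_le_power2[of "norm (x' - x0')"] by linarith+
  then have "norm (x - x0) \<le> 3 * e" "norm (x' - x0') \<le> 3 * e" using e by (auto intro: power2_le_imp_le)
  then show ?thesis using x 1 by (intro bexI[of _ "(x, x', r)"]) (auto simp: power_divide)
qed

lemma geometric_steps_converge:
  fixes x :: "nat \<Rightarrow> 'v::banach"
  assumes "\<And>n. norm (x (Suc n) - x n) \<le> K * (1/2) ^ n"
  obtains y where "x \<longlonglongrightarrow> y" "norm (y - x 0) \<le> 2 * K"
proof -
  let ?d = "\<lambda>n. x (Suc n) - x n"
  have g: "(\<lambda>n. K * (1/2) ^ n) sums (K * 2)" using sums_mult[OF geometric_sums[of "1/2 :: real"], of K] by simp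
  have s: "summable ?d" by (rule summable_comparison_test'[OF sums_summable[OF g], of 0]) (use assms in auto)
  have "norm (suminf ?d) \<le> K * 2"
    using norm_suminf_le[of ?d "\<lambda>n. K * (1/2) ^ n"] assms g by (metis sums_summable sums_unique)
  moreover have "(\<lambda>n. x n - x 0) \<longlonglongrightarrow> suminf ?d"
    using summable_LIMSEQ[OF s] by (simp only: sum_lessThan_telescope)
  then have "(\<lambda>n. (x n - x 0) + x 0) \<longlonglongrightarrow> suminf ?d + x 0" by (intro tendsto_add tendsto_const)
  ultimately show ?thesis using that[of "suminf ?d + x 0"] by simp
qed

text \<open>The convexity inequality is written for the approximating points and passed to the
  limit, so the limit itself need not lie in \<open>E\<close>.\<close>

lemma assoc_op_limit:
  assumes E: "strong_set E" and z: "\<And>n. (x n, x' n, r n) \<in> E" "\<And>n. r n - (x' n) (x n) \<le> d n" "d \<longlonglongrightarrow> 0"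
    and lim: "x \<longlonglongrightarrow> y" "x' \<longlonglongrightarrow> y'"
  shows "y' \<in> assoc_op E y"
proof -
  have "y' v + v' y \<le> y' y + s" if v: "(v, v', s) \<in> E" for v v' s
  proof (rule convex_tangent_le)
    fix t :: real assume t: "0 < t" "t < 1"
    have "((1 - t) *\<^sub>R x' n + t *\<^sub>R v') ((1 - t) *\<^sub>R x n + t *\<^sub>R v) \<le> (1 - t) * ((x' n) (x n) + d n) + t * s" for n
    proof -
      have "(1 - t) *\<^sub>R (x n, x' n, r n) + t *\<^sub>R (v, v', s) \<in> E"
        using t v z by (intro convexD[OF strong_setD(1)[OF E]]) auto
      then have "((1 - t) *\<^sub>R x' n + t *\<^sub>R v') ((1 - t) *\<^sub>R x n + t *\<^sub>R v) \<le> (1 - t) * r n + t * s"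
        by (intro strong_setD(2)[OF E]) simp
      also have "\<dots> \<le> (1 - t) * ((x' n) (x n) + d n) + t * s"
        using z(2)[of n] t by (intro add_right_mono mult_left_mono) auto
      finally show ?thesis .
    qed
    moreover have "(\<lambda>n. ((1 - t) *\<^sub>R x' n + t *\<^sub>R v') ((1 - t) *\<^sub>R x n + t *\<^sub>R v)) \<longlonglongrightarrow> ((1 - t) *\<^sub>R y' + t *\<^sub>R v') ((1 - t) *\<^sub>R y + t *\<^sub>R v)"
      by (intro blinfun.tendsto tendsto_intros lim)
    moreover have "(\<lambda>n. (1 - t) * ((x' n) (x n) + d n) + t * s) \<longlonglongrightarrow> (1 - t) * (y' y + 0) + t * s"
      by (intro blinfun.tendsto tendsto_intros lim z)
    ultimately have "((1 - t) *\<^sub>R y' + t *\<^sub>R v') ((1 - t) *\<^sub>R y + t *\<^sub>R v) \<le> (1 - t) * (y' y + 0) + t * s"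
      by (intro LIMSEQ_le) auto
    then show "(1 - t)\<^sup>2 * y' y + t * (1 - t) * (y' v + v' y) + t\<^sup>2 * v' v \<le> (1 - t) * y' y + t * s"
      by (simp add: blinfun.bilinear_simps algebra_simps power2_eq_square)
  qed
  then show ?thesis by (fastforce simp: assoc_op_def conj_le_def)
qed

text \<open>Iterates \<open>strong_set_near_graph_step\<close> with \<open>e\<close>,
  \<open>e / 2\<close>, \<open>e / 4\<close>, and so on. The moves in each component sum to at most
  \<open>6 * e\<close>, and the limit belongs to the operator by
  \<open>assoc_op_limit\<close>.\<close>

theorem strong_set_bronsted_rockafellar:
  fixes E :: "('a::banach \<times> 'a dual \<times> real) set"
  assumes E: "strong_set E" and x0: "(x0, x0', r0) \<in> E" "r0 - x0' x0 \<le> e\<^sup>2" and e: "e > 0"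
  shows "\<exists>x x'. x' \<in> assoc_op E x \<and> norm (x - x0) \<le> 6 * e \<and> norm (x' - x0') \<le> 6 * e"
proof -
  define P where "P n z \<longleftrightarrow> z \<in> E \<and> snd (snd z) - blinfun_apply (fst (snd z)) (fst z) \<le> (e * (1/2) ^ n)\<^sup>2 \<and> (n = 0 \<longrightarrow> z = (x0, x0', r0))"
    for n :: nat and z
  define Q where "Q n z w \<longleftrightarrow> norm (fst w - fst z) \<le> 3 * (e * (1/2) ^ n) \<and> norm (fst (snd w) - fst (snd z)) \<le> 3 * (e * (1/2) ^ n)"
    for n :: nat and z w :: "'a \<times> 'a dual \<times> real"
  have "\<exists>f. \<forall>n. P n (f n) \<and> Q n (f n) (f (Suc n))"
  proof (rule dependent_nat_choice)
    show "\<exists>z. P 0 z" using x0 by (auto simp: P_def)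
    fix z n assume "P n z"
    then show "\<exists>w. P (Suc n) w \<and> Q n z w"
      using strong_set_near_graph_step[OF E, of "fst z" "fst (snd z)" "snd (snd z)" "e * (1/2) ^ n"] e
      unfolding P_def Q_def by fastforce
  qed
  then obtain f where P: "\<And>n. P n (f n)" and Q: "\<And>n. Q n (f n) (f (Suc n))" by blast
  have f0: "f 0 = (x0, x0', r0)" using P[of 0] by (simp add: P_def)
  obtain x where x: "(\<lambda>n. fst (f n)) \<longlonglongrightarrow> x" "norm (x - fst (f 0)) \<le> 2 * (3 * e)"
    using geometric_steps_converge[of "\<lambda>n. fst (f n)" "3 * e"] Q unfolding Q_def by (auto simp: mult.assoc)
  obtain x' where x': "(\<lambda>n. fst (snd (f n))) \<longlonglongrightarrow> x'" "norm (x' - fst (snd (f 0))) \<le> 2 * (3 * e)"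
    using geometric_steps_converge[of "\<lambda>n. fst (snd (f n))" "3 * e"] Q unfolding Q_def by (auto simp: mult.assoc)
  have "(\<lambda>n. (e * (1/2) ^ n)\<^sup>2) \<longlonglongrightarrow> (e * 0)\<^sup>2" by (intro tendsto_intros LIMSEQ_power_zero) auto
  then have "(\<lambda>n. (e * (1/2) ^ n)\<^sup>2) \<longlonglongrightarrow> 0" by (simp only: mult_zero_right zero_power2)
  from assoc_op_limit[OF E _ _ this x(1) x'(1), of "\<lambda>n. snd (snd (f n))"] have "x' \<in> assoc_op E x"
    using P unfolding P_def by simp
  then show ?thesis using x x' f0 by auto
qed

text \<open>Combines near-minimality with the Bronsted-Rockafellar property. The case
  \<open>l = 1\<close> serves maximality, a small weight \<open>l\<close> serves condition
  (NI).\<close>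

lemma strong_set_near_graph_point:
  fixes E :: "('a::banach \<times> 'a dual \<times> real) set"
  assumes E: "strong_set E" and l: "l > 0" and e: "e > 0" and d: "d > 0"
  shows "\<exists>x x' w w'. w' \<in> assoc_op E w \<and> norm (w - x) \<le> d \<and> norm (w' - x') \<le> d \<and>
    (x' - x0') (x - x0) + l / 2 * (norm (x - x0))\<^sup>2 + 1 / (2 * l) * (norm (x' - x0'))\<^sup>2 \<le> e"
proof -
  have "min e ((d / 6)\<^sup>2) > 0" using e d by simp
  from strong_set_near_minimum[OF E l this, of x0' x0] obtain x x' r where x: "(x, x', r) \<in> E"
    and min: "r - (blinfun_apply x0' x + blinfun_apply x' x0 - blinfun_apply x0' x0) + l / 2 * (norm (x - x0))\<^sup>2
      + 1 / (2 * l) * (norm (x' - x0'))\<^sup>2 < min e ((d / 6)\<^sup>2)" by auto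
  define q where "q = (x' - x0') (x - x0)"
  have q: "x0' x + x' x0 - x0' x0 = x' x - q" by (simp add: q_def blinfun.bilinear_simps)
  have "- (norm (x' - x0') * norm (x - x0)) \<le> q" unfolding q_def by (rule blinfun_ge)
  moreover have "norm (x - x0) * norm (x' - x0') \<le> l / 2 * (norm (x - x0))\<^sup>2 + 1 / (2 * l) * (norm (x' - x0'))\<^sup>2"
    by (rule weighted_young[OF l])
  ultimately have "r - x' x \<le> (d / 6)\<^sup>2" using min unfolding q by (simp add: mult.commute)
  from strong_set_bronsted_rockafellar[OF E x this] obtain w w' where
    "w' \<in> assoc_op E w" "norm (w - x) \<le> d" "norm (w' - x') \<le> d" using d by auto
  moreover have "q + l / 2 * (norm (x - x0))\<^sup>2 + 1 / (2 * l) * (norm (x' - x0'))\<^sup>2 \<le> e"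
    using min strong_setD(2)[OF E x] unfolding q by simp
  ultimately show ?thesis unfolding q_def by blast
qed

lemma assoc_op_closed: "closed {p. snd p \<in> assoc_op E (fst p)}"
proof -
  have "{p. snd p \<in> assoc_op E (fst p)}
      = (\<Inter>(y, y', r)\<in>E. {p. blinfun_apply (snd p) y + blinfun_apply y' (fst p) - r \<le> blinfun_apply (snd p) (fst p)})"
    by (auto simp: assoc_op_def conj_le_def)
  also have "closed \<dots>"
    by (auto intro!: closed_INT closed_Collect_le blinfun.continuous_on continuous_intros)
  finally show ?thesis .
qed

text \<open>If a point is monotonically related to the graph, its product with a nearly minimal
  graph point is nonnegative, so near-minimality forces both squared norms to be small. The point is
  thus in the closure of the graph, which is closed.\<close>

lemma assoc_op_maximal:
  fixes E :: "('a::banach \<times> 'a dual \<times> real) set"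
  assumes E: "strong_set E"
    and rel: "\<And>w w'. w' \<in> assoc_op E w \<Longrightarrow> (x0' - w') (x0 - w) \<ge> 0"
  shows "x0' \<in> assoc_op E x0"
proof -
  let ?G = "{p. snd p \<in> assoc_op E (fst p)}"
  have "\<exists>p\<in>?G. dist p (x0, x0') < e" if e: "e > 0" for e
  proof -
    \<comment> \<open>The final estimate is \<open>5 * d\<close> in each component, together below
      \<open>e\<close>.\<close>
    define d where "d = e / 12"
    have d: "d > 0" using e by (simp add: d_def)
    obtain x x' w w' where w: "w' \<in> assoc_op E w" "norm (w - x) \<le> d" "norm (w' - x') \<le> d"
      and min: "(x' - x0') (x - x0) + 1 / 2 * (norm (x - x0))\<^sup>2 + 1 / (2 * 1) * (norm (x' - x0'))\<^sup>2 \<le> d\<^sup>2"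
      using strong_set_near_graph_point[OF E, of 1 "d\<^sup>2" d x0' x0] d by auto
    define a b where "a = norm (x - x0)" and "b = norm (x' - x0')"
    have ab: "a \<ge> 0" "b \<ge> 0" by (auto simp: a_def b_def)
    have "0 \<le> (w' - x0') (w - x0)"
      using rel[OF w(1)] by (simp add: blinfun.bilinear_simps)
    also have "\<dots> = (x' - x0') (x - x0) + (w' - x') (x - x0) + (x' - x0') (w - x) + (w' - x') (w - x)"
      by (simp add: blinfun.bilinear_simps)
    also have "\<dots> \<le> (x' - x0') (x - x0) + d * a + b * d + d * d"
      using blinfun_le[of "w' - x'" "x - x0"] blinfun_le[of "x' - x0'" "w - x"] blinfun_le[of "w' - x'" "w - x"]
        mult_right_mono[OF w(3), of a] mult_left_mono[OF w(2), of b] mult_mono[OF w(3,2)] ab d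
      unfolding a_def[symmetric] b_def[symmetric] by auto
    finally have "1 / 2 * a\<^sup>2 + 1 / 2 * b\<^sup>2 \<le> 2 * d\<^sup>2 + d * a + d * b"
      using min unfolding a_def[symmetric] b_def[symmetric] by (simp add: power2_eq_square mult.commute)
    then have "(a - d)\<^sup>2 + (b - d)\<^sup>2 \<le> 6 * d\<^sup>2" by (simp add: power2_eq_square algebra_simps)
    moreover have "(3 * d)\<^sup>2 = 9 * d\<^sup>2" by (simp add: power_mult_distrib)
    ultimately have "(a - d)\<^sup>2 \<le> (3 * d)\<^sup>2" "(b - d)\<^sup>2 \<le> (3 * d)\<^sup>2"
      using zero_le_power2[of "a - d"] zero_le_power2[of "b - d"] zero_le_power2[of d] by linarith+
    then have "a - d \<le> 3 * d" "b - d \<le> 3 * d" using d by (meson power2_le_imp_le mult_nonneg_nonneg less_imp_le zero_le_numeral)+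
    then have "norm (w - x0) \<le> 5 * d" "norm (w' - x0') \<le> 5 * d"
      using norm_triangle_ineq[of "w - x" "x - x0"] norm_triangle_ineq[of "w' - x'" "x' - x0'"] w
      unfolding a_def b_def by simp_all
    moreover have "dist (w, w') (x0, x0') \<le> norm (w - x0) + norm (w' - x0')"
      unfolding dist_Pair_Pair dist_norm[of w] dist_norm[of w'] by (rule sqrt_sum_squares_le_sum) auto
    ultimately have "dist (w, w') (x0, x0') < e" using e by (simp add: d_def)
    then show ?thesis using w(1) by (intro bexI[of _ "(w, w')"]) auto
  qed
  then have "(x0, x0') \<in> closure ?G" by (simp add: closure_approachable)
  then show ?thesis using assoc_op_closed[of E] by (simp add: closure_closed)
qed

text \<open>Condition (NI). The weight \<open>l\<close> makes the distance of \<open>x''\<close> to \<open>X\<close> negligible.\<close>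

lemma assoc_op_negative_infimum:
  fixes E :: "('a::banach \<times> 'a dual \<times> real) set" and x0' :: "'a dual" and x'' :: "'a bidual"
  assumes E: "strong_set E" and e: "e > 0"
  shows "\<exists>w w'. w' \<in> assoc_op E w \<and> (w' - x0') w - x'' (w' - x0') \<le> e"
proof -
  define k where "k = norm x''"
  have k: "k \<ge> 0" by (simp add: k_def)
  \<comment> \<open>This weight gives \<open>l / 2 * (1 + k)\<^sup>2\<close> the value
    \<open>e / 4\<close>; \<open>C\<close> collects the coefficients of \<open>d\<close> in the
    estimate, and \<open>d\<close> is small enough for \<open>d * C\<close> to be at most
    \<open>e / 4\<close>.\<close>
  define l where "l = e / (2 * (1 + k)\<^sup>2)"
  have l: "l > 0" using e k by (simp add: l_def)
  define C where "C = 1 / (2 * l) + 1 + k"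
  have C: "C > 0" using l k by (simp add: C_def add_pos_nonneg add_pos_pos)
  define d where "d = min 1 (e / (4 * C))"
  have d: "0 < d" "d \<le> 1" "d * C \<le> e / 4" using e C by (auto simp: d_def min_def field_simps)
  \<comment> \<open>Near-minimality is used around \<open>(0, x0')\<close>; the bidual element
    enters only through its norm \<open>k\<close>.\<close>
  obtain x x' w w' where w: "w' \<in> assoc_op E w" "norm (w - x) \<le> d" "norm (w' - x') \<le> d"
    and min: "(x' - x0') (x - 0) + l / 2 * (norm (x - 0))\<^sup>2 + 1 / (2 * l) * (norm (x' - x0'))\<^sup>2 \<le> e / 4"
    using strong_set_near_graph_point[OF E l, of "e / 4" d x0' 0] e d by auto
  define a b where "a = norm x" and "b = norm (x' - x0')"
  have ab: "a \<ge> 0" "b \<ge> 0" by (auto simp: a_def b_def)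
  have "(w' - x0') w - x'' (w' - x0') = (x' - x0') x + (w' - x') x + (x' - x0') (w - x) + (w' - x') (w - x)
      - x'' (x' - x0') - x'' (w' - x')"
    by (simp add: blinfun.bilinear_simps)
  also have "\<dots> \<le> (x' - x0') x + d * a + b * d + d * d + k * b + k * d"
  proof -
    have "(w' - x') x \<le> d * a"
      using blinfun_le[of "w' - x'" x] mult_right_mono[OF w(3), of a] ab by (simp add: a_def)
    moreover have "(x' - x0') (w - x) \<le> b * d"
      using blinfun_le[of "x' - x0'" "w - x"] mult_left_mono[OF w(2), of b] ab by (simp add: b_def)
    moreover have "(w' - x') (w - x) \<le> d * d"
      using blinfun_le[of "w' - x'" "w - x"] mult_mono[OF w(3,2)] d by simp
    moreover have "- x'' (x' - x0') \<le> k * b" using blinfun_ge[of x'' "x' - x0'"] by (simp add: k_def b_def)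
    moreover have "- x'' (w' - x') \<le> k * d"
      using blinfun_ge[of x'' "w' - x'"] mult_left_mono[OF w(3) k] by (simp add: k_def)
    ultimately show ?thesis by linarith
  qed
  also have "\<dots> \<le> e / 4 + (d * a - l / 2 * a\<^sup>2) + ((d + k) * b - 1 / (2 * l) * b\<^sup>2) + d * d + k * d"
    using min unfolding a_def b_def by (simp add: algebra_simps)
  also have "\<dots> \<le> e / 4 + 1 / (2 * l) * d\<^sup>2 + l / 2 * (d + k)\<^sup>2 + d * d + k * d"
    using weighted_young[OF l, of a d] weighted_young[OF l, of "d + k" b] by (simp add: mult.commute)
  also have "\<dots> \<le> e / 4 + 1 / (2 * l) * d + l / 2 * (1 + k)\<^sup>2 + d + k * d"
  proof -
    have "d\<^sup>2 \<le> d" "d * d \<le> d" using d by (auto simp: power2_eq_square mult_left_le)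
    moreover from this have "1 / (2 * l) * d\<^sup>2 \<le> 1 / (2 * l) * d" using l by (intro mult_left_mono) auto
    moreover have "l / 2 * (d + k)\<^sup>2 \<le> l / 2 * (1 + k)\<^sup>2" using l d k by (intro mult_left_mono power_mono) auto
    ultimately show ?thesis by linarith
  qed
  also have "\<dots> = e / 4 + l / 2 * (1 + k)\<^sup>2 + d * C" by (simp add: C_def algebra_simps)
  also have "l / 2 * (1 + k)\<^sup>2 = e / 4" using k by (simp add: l_def)
  also have "e / 4 + e / 4 + d * C \<le> e" using d e by simp
  finally show ?thesis using w(1) by blast
qed

section \<open>The lifted graph and type (D)\<close>

text \<open>Its lower boundary is the convex hull of the coupling restricted to the graph; the
  conjugate of that function is the Fitzpatrick function, taken on the product of dual and
  bidual.\<close>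

definition graph_hull :: "('a::real_normed_vector \<Rightarrow> 'a dual set) \<Rightarrow> ('a \<times> 'a dual \<times> real) set" where
  "graph_hull W = convex hull {(w, w', blinfun_apply w' w) | w w'. w' \<in> W w}"

lemma graph_hull_incl: "w' \<in> W w \<Longrightarrow> (w, w', blinfun_apply w' w) \<in> graph_hull W"
  unfolding graph_hull_def by (intro hull_inc) auto

lemma graph_hull_conj_le:
  fixes W :: "'a::real_normed_vector \<Rightarrow> 'a dual set"
  assumes "\<And>w w'. w' \<in> W w \<Longrightarrow> blinfun_apply x' w + blinfun_apply x'' w' - blinfun_apply w' w \<le> b"
  shows "conj_le (graph_hull W) x' x'' b"
proof -
  let ?H = "{(y, y', r). blinfun_apply x' y + blinfun_apply x'' y' - r \<le> b}"
  have "convex ?H"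
  proof (rule convexI)
    fix p q and u v :: real
    assume pq: "p \<in> ?H" "q \<in> ?H" and uv: "0 \<le> u" "0 \<le> v" "u + v = 1"
    obtain y1 y1' r1 where p: "p = (y1, y1', r1)" by (metis surj_pair)
    obtain y2 y2' r2 where q: "q = (y2, y2', r2)" by (metis surj_pair)
    have "u * (x' y1 + x'' y1' - r1) + v * (x' y2 + x'' y2' - r2) \<le> u * b + v * b"
      using pq uv unfolding p q by (intro add_mono mult_left_mono) auto
    also have "u * b + v * b = b" using uv by (metis distrib_right mult_1)
    finally show "u *\<^sub>R p + v *\<^sub>R q \<in> ?H"
      by (simp add: p q blinfun.bilinear_simps algebra_simps)
  qed
  then have "graph_hull W \<subseteq> ?H" unfolding graph_hull_def using assms by (intro hull_minimal) auto
  then show ?thesis by (auto simp: conj_le_def)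
qed

text \<open>A point of the hull below the coupling would be monotonically related to the graph,
  hence on it by maximality, and its own tangent would then put it above the coupling. The bound on
  the conjugate is condition (NI).\<close>

lemma graph_hull_strong:
  fixes E :: "('a::banach \<times> 'a dual \<times> real) set"
  assumes E: "strong_set E"
  shows "strong_set (graph_hull (assoc_op E))"
proof -
  let ?W = "assoc_op E"
  have "blinfun_apply x' x \<le> r" if x: "(x, x', r) \<in> graph_hull ?W" for x x' r
  proof (rule ccontr)
    assume neg: "\<not> ?thesis"
    have tangent: "blinfun_apply w' x + blinfun_apply x' w - blinfun_apply w' w \<le> r" if w: "w' \<in> ?W w" for w w'
    proof -
      have "conj_le (graph_hull ?W) w' (dual_eval w) (w' w)"
      proof (rule graph_hull_conj_le)
        fix v v' assume "v' \<in> ?W v"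
        from assoc_op_monotone[OF E w this] show "w' v + (dual_eval w) v' - v' v \<le> w' w"
          by (simp add: blinfun.bilinear_simps)
      qed
      then show ?thesis using x by (fastforce simp: conj_le_def)
    qed
    have "x' \<in> ?W x"
    proof (rule assoc_op_maximal[OF E])
      fix w w' assume "w' \<in> ?W w"
      from tangent[OF this] show "0 \<le> (x' - w') (x - w)" using neg by (simp add: blinfun.bilinear_simps)
    qed
    from tangent[OF this] neg show False by simp
  qed
  moreover have "x'' x' \<le> b" if b: "conj_le (graph_hull ?W) x' x'' b" for x' x'' b
  proof (rule field_le_epsilon)
    fix e :: real assume "e > 0"
    from assoc_op_negative_infimum[OF E this, of x' x''] obtain w w' where
      "w' \<in> ?W w" "(w' - x') w - x'' (w' - x') \<le> e" by blast
    moreover from this have "x' w + x'' w' - w' w \<le> b"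
      using b graph_hull_incl[of w' ?W w] by (auto simp: conj_le_def)
    ultimately show "x'' x' \<le> b + e" by (simp add: blinfun.bilinear_simps)
  qed
  ultimately show ?thesis unfolding strong_set_def by (auto simp: graph_hull_def convex_convex_hull)
qed

text \<open>Ensures that approximations found for the hull are points of the original graph: the
  inequalities at lifted graph points express monotone relatedness, and maximality applies.\<close>

lemma assoc_op_graph_hull:
  fixes E :: "('a::banach \<times> 'a dual \<times> real) set"
  assumes E: "strong_set E" and x: "x' \<in> assoc_op (graph_hull (assoc_op E)) x"
  shows "x' \<in> assoc_op E x"
proof (rule assoc_op_maximal[OF E])
  fix w w' assume "w' \<in> assoc_op E w"
  from graph_hull_incl[of w' "assoc_op E", OF this] show "(x' - w') (x - w) \<ge> 0"
    using x by (fastforce simp: assoc_op_def conj_le_def blinfun.bilinear_simps)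
qed

text \<open>By duality, failure would produce a point at which the conjugate
  lies below the tangent at \<open>(x', x'')\<close>.\<close>

lemma strong_set_bounded_approximation:
  fixes E :: "('a::banach \<times> 'a dual \<times> real) set"
  assumes E: "strong_set E" and x: "conj_le E x' x'' (x'' x')" and F: "finite F" and e: "e > 0"
    and v0: "(v0, v0', r0) \<in> E" "norm v0 < B" and B: "norm x'' \<le> B"
  shows "\<exists>(v, v', r)\<in>E. norm v \<le> B \<and> norm (v' - x') < e \<and> (\<forall>f\<in>F. \<bar>blinfun_apply f v - x'' f\<bar> < e) \<and> r < x'' x' + e"
proof (rule ccontr)
  assume "\<not> ?thesis"
  then have H: "\<And>v v' r. (v, v', r) \<in> E \<Longrightarrow> norm v \<le> B \<Longrightarrow>
      norm (v' - x') \<ge> e \<or> (\<exists>f\<in>F. \<bar>blinfun_apply f v - x'' f\<bar> \<ge> e) \<or> r \<ge> x'' x' + e"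
    by (fastforce simp: not_less)
  define m where "m = x'' x' + e"
  have B0: "B > 0" using v0(2) norm_ge_zero[of v0] by linarith
  \<comment> \<open>The penalty constant is so large that violating a single constraint by
    \<open>e\<close> outweighs the lower bound that the coupling imposes on \<open>r\<close> over
    the ball.\<close>
  define K where "K = B + (B * norm x' + \<bar>m\<bar>) / e"
  have K: "K \<ge> B" "(K - B) * e = B * norm x' + \<bar>m\<bar>" using e B0 by (auto simp: K_def)
  have K0: "K \<ge> 0" using K B0 by simp
  define pf where "pf = (\<lambda>(v, v' :: 'a dual, r :: real). (\<Sum>f\<in>F. K * \<bar>blinfun_apply f v - x'' f\<bar>))"
  define jd where "jd = (\<lambda>(v :: 'a, v', r :: real). v' - x')"
  define p where "p c = K * norm (jd c) + (pf c + snd (snd c))" for c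
  have low: "m \<le> p (v, v', r)" if v: "(v, v', r) \<in> E" "norm v \<le> B" for v v' r
  proof -
    have "v' v \<le> r" by (rule strong_setD(2)[OF E v(1)])
    moreover have "v' v = (v' - x') v + x' v" by (simp add: blinfun.bilinear_simps)
    moreover have "- (norm (v' - x') * B) \<le> (v' - x') v"
      using blinfun_ge[of "v' - x'" v] mult_left_mono[OF v(2), of "norm (v' - x')"] by simp
    moreover have "- (norm x' * B) \<le> x' v"
      using blinfun_ge[of x' v] mult_left_mono[OF v(2), of "norm x'"] by simp
    ultimately have r: "r \<ge> - (B * norm (v' - x')) - B * norm x'" by (simp add: mult.commute)
    let ?S = "\<Sum>f\<in>F. K * \<bar>blinfun_apply f v - x'' f\<bar>"
    have S: "?S \<ge> 0" using K0 by (intro sum_nonneg) auto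
    consider "norm (v' - x') \<ge> e" | f where "f \<in> F" "\<bar>blinfun_apply f v - x'' f\<bar> \<ge> e" | "r \<ge> m"
      using H[OF v] by (auto simp: m_def)
    then show ?thesis
    proof cases
      case 1
      have "(K - B) * e \<le> (K - B) * norm (v' - x')" using 1 K by (intro mult_left_mono) auto
      then have "m \<le> K * norm (v' - x') + r" using r K by (simp add: algebra_simps)
      then show ?thesis using S by (simp add: p_def pf_def jd_def)
    next
      case 2
      have "K * e \<le> K * \<bar>blinfun_apply f v - x'' f\<bar>" using 2 K0 by (intro mult_left_mono) auto
      also have "\<dots> \<le> ?S" using 2 F K0 by (intro member_le_sum) auto
      finally have "K * e \<le> ?S" .
      moreover have "(K - B) * e \<le> K * e" using B0 e by (intro mult_right_mono) auto
      moreover have "B * norm (v' - x') \<le> K * norm (v' - x')" using K by (intro mult_right_mono) auto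
      ultimately show ?thesis using r K(2) by (simp add: p_def pf_def jd_def)
    next
      case 3
      have "0 \<le> K * norm (v' - x')" using K0 by simp
      then show ?thesis using 3 S by (simp add: p_def pf_def jd_def)
    qed
  qed
  have convE: "convex E" by (rule strong_setD(1)[OF E])
  have jd_eq: "jd ((1 - t) *\<^sub>R a + t *\<^sub>R b) = (1 - t) *\<^sub>R jd a + t *\<^sub>R jd b" for t a b
    by (auto simp: jd_def algebra_simps split: prod.splits)
  have conv_pf: "pf ((1 - t) *\<^sub>R a + t *\<^sub>R b) \<le> (1 - t) * pf a + t * pf b" if t: "0 < t" "t < 1" for t a b
  proof -
    obtain v v' r where a: "a = (v, v', r)" by (metis surj_pair)
    obtain u u' s where b: "b = (u, u', s)" by (metis surj_pair)
    have "\<bar>f ((1 - t) *\<^sub>R v + t *\<^sub>R u) - x'' f\<bar> \<le> (1 - t) * \<bar>f v - x'' f\<bar> + t * \<bar>f u - x'' f\<bar>" for f :: "'a dual"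
    proof -
      have "f ((1 - t) *\<^sub>R v + t *\<^sub>R u) - x'' f = (1 - t) * (f v - x'' f) + t * (f u - x'' f)"
        by (simp add: blinfun.bilinear_simps algebra_simps)
      then show ?thesis using abs_triangle_ineq[of "(1 - t) * (f v - x'' f)" "t * (f u - x'' f)"] t by (simp add: abs_mult)
    qed
    from mult_left_mono[OF this K0]
    have "(\<Sum>f\<in>F. K * \<bar>blinfun_apply f ((1 - t) *\<^sub>R v + t *\<^sub>R u) - x'' f\<bar>) \<le> (\<Sum>f\<in>F. (1 - t) * (K * \<bar>blinfun_apply f v - x'' f\<bar>) + t * (K * \<bar>blinfun_apply f u - x'' f\<bar>))"
      by (intro sum_mono) (simp add: algebra_simps)
    then show ?thesis by (simp add: pf_def a b sum.distrib sum_distrib_left)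
  qed
  have convp: "p ((1 - t) *\<^sub>R a + t *\<^sub>R b) \<le> (1 - t) * p a + t * p b" if t: "0 < t" "t < 1" for t a b
  proof -
    have "norm (jd ((1 - t) *\<^sub>R a + t *\<^sub>R b)) \<le> (1 - t) * norm (jd a) + t * norm (jd b)"
      unfolding jd_eq using norm_triangle_ineq[of "(1 - t) *\<^sub>R jd a" "t *\<^sub>R jd b"] t by simp
    from mult_left_mono[OF this K0] conv_pf[OF t, of a b] show ?thesis
      unfolding p_def by (simp add: algebra_simps)
  qed
  let ?C = "E \<times> cball (0::'a) B"
  define k where "k = (\<lambda>(a, b :: 'a). p a)"
  define j where "j = (\<lambda>((v, v' :: 'a dual, r :: real), b). v - b :: 'a)"
  \<comment> \<open>First dualisation: the bound on \<open>v\<close> is written as equality with a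
    point \<open>b\<close> of the ball, and \<open>v0\<close>, of norm less than \<open>B\<close>,
    provides the Slater condition.\<close>
  have "\<exists>g :: 'a dual. \<forall>c\<in>?C. m \<le> g (j c) + k c"
  proof (rule qualified_constraint_multiplier[where L = UNIV and d = "B - norm v0"])
    show "?C \<noteq> {}" using v0 B0 by auto
    show "convex_on ?C k"
    proof (rule convex_onI)
      show "convex ?C" using convE by (intro convex_Times) auto
      show "k ((1 - t) *\<^sub>R c + t *\<^sub>R c') \<le> (1 - t) * k c + t * k c'" if "0 < t" "t < 1" for t c c'
        using convp[OF that, of "fst c" "fst c'"] by (simp add: k_def case_prod_unfold)
    qed
    show "j ((1 - t) *\<^sub>R x + t *\<^sub>R y) = (1 - t) *\<^sub>R j x + t *\<^sub>R j y" for x y t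
      unfolding j_def by (auto split: prod.splits simp: algebra_simps)
    show "\<exists>c\<in>?C. j c = u \<and> k c \<le> p (v0, v0', r0)" if "norm u \<le> B - norm v0" for u
      using v0 that norm_triangle_ineq4[of v0 u]
      by (intro bexI[of _ "((v0, v0', r0), v0 - u)"]) (auto simp: j_def k_def)
    show "m \<le> k c" if "c \<in> ?C" "j c = 0" for c using that low by (auto simp: j_def k_def)
  qed (use v0 in auto)
  then obtain g :: "'a dual" where g: "\<And>c. c \<in> ?C \<Longrightarrow> m \<le> g (j c) + k c" by blast
  \<comment> \<open>Choosing \<open>b\<close> where \<open>g\<close> almost attains its maximum on
    the ball turns the multiplier into the term \<open>B * norm g\<close>, at the cost of
    \<open>e / 2\<close>.\<close>
  define m' where "m' = x'' x' + e / 2 + B * norm g"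
  obtain u where u: "norm u \<le> 1" "norm g - e / (2 * B) \<le> g u"
    using blinfun_almost_attains[of "e / (2 * B)" g] e B0 by auto
  have "B * (norm g - e / (2 * B)) \<le> B * g u" using u B0 by (intro mult_left_mono) auto
  then have gu: "B * norm g - e / 2 \<le> g (B *\<^sub>R u)" using B0 by (simp add: blinfun.scaleR_right algebra_simps)
  have Bu: "norm (B *\<^sub>R u) \<le> B" using u B0 by (simp add: mult_left_le)
  define lin where "lin = (\<lambda>(v, v' :: 'a dual, r). r + blinfun_apply g v)"
  have lin_eq: "lin ((1 - t) *\<^sub>R a + t *\<^sub>R b) = (1 - t) * lin a + t * lin b" for t a b
    by (auto simp: lin_def blinfun.bilinear_simps algebra_simps split: prod.splits)
  have pen: "m' \<le> K * norm (jd c) + (pf c + lin c)" if "c \<in> E" for c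
  proof -
    obtain v v' r where c: "c = (v, v', r)" by (metis surj_pair)
    show ?thesis using g[of "(c, B *\<^sub>R u)"] that gu Bu
      by (simp add: j_def k_def p_def m_def m'_def lin_def c blinfun.bilinear_simps)
  qed
  \<comment> \<open>Second and third dualisation: the norm of \<open>v' - x'\<close>, then the
    finitely many absolute values.\<close>
  have "\<exists>y :: 'a bidual. \<forall>c\<in>E. m' \<le> y (jd c) + (pf c + lin c)"
  proof (rule norm_penalty_linear[where K = K])
    show "E \<noteq> {}" using v0 by auto
    show "convex_on E (\<lambda>c. pf c + lin c)"
    proof (intro convex_on_add)
      show "convex_on E lin" using lin_eq convE by (intro convex_onI) auto
      show "convex_on E pf" using conv_pf convE by (intro convex_onI) auto
    qed
    show "m' \<le> K * norm (jd c) + (pf c + lin c)" if "c \<in> E" for c by (rule pen[OF that])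
  qed (use jd_eq K0 in auto)
  then obtain y :: "'a bidual" where y: "\<And>c. c \<in> E \<Longrightarrow> m' \<le> y (jd c) + (pf c + lin c)" by blast
  define ll where "ll = (\<lambda>f (v, v' :: 'a dual, r :: real). blinfun_apply f v - x'' f)"
  have "\<exists>a. \<forall>c\<in>E. m' \<le> (\<Sum>f\<in>F. a f * ll f c) + (y (jd c) + lin c)"
  proof (rule finite_abs_penalty_linear[OF F _ K0])
    show "E \<noteq> {}" using v0 by auto
    show "ll f ((1 - t) *\<^sub>R a + t *\<^sub>R b) = (1 - t) * ll f a + t * ll f b" for f t a b
      by (auto simp: ll_def blinfun.bilinear_simps algebra_simps split: prod.splits)
    show "convex_on E (\<lambda>c. y (jd c) + lin c)"
      by (intro convex_onI convE) (simp add: jd_eq lin_eq blinfun.bilinear_simps distrib_left)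
    show "m' \<le> (\<Sum>f\<in>F. K * \<bar>ll f c\<bar>) + (y (jd c) + lin c)" if "c \<in> E" for c
      using y[OF that] by (auto simp: pf_def ll_def split: prod.splits)
  qed
  then obtain a where a: "\<And>c. c \<in> E \<Longrightarrow> m' \<le> (\<Sum>f\<in>F. a f * ll f c) + (y (jd c) + lin c)" by blast
  define h where "h = (\<Sum>f\<in>F. a f *\<^sub>R f)"
  have hv: "h v = (\<Sum>f\<in>F. a f * blinfun_apply f v)" for v
    by (simp add: h_def blinfun.sum_left blinfun.scaleR_left)
  have xh: "x'' h = (\<Sum>f\<in>F. a f * x'' f)"
    by (simp add: h_def blinfun.sum_right blinfun.scaleR_right)
  \<comment> \<open>With all penalties linear, the inequality bounds the conjugate at
    \<open>(- h - g, - y)\<close>. The tangent at \<open>(x', x'')\<close> then leaves only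
    \<open>x'' g\<close>, which is at most \<open>B * norm g\<close>.\<close>
  have "conj_le E (- h - g) (- y) (- m' - x'' h - y x')"
    unfolding conj_le_def
  proof clarify
    fix v v' r assume "(v, v', r) \<in> E"
    from a[OF this] have "m' \<le> h v - x'' h + (y (v' - x') + (r + g v))"
      by (simp add: ll_def jd_def lin_def hv xh sum_subtractf right_diff_distrib)
    then show "(- h - g) v + (- y) v' - r \<le> - m' - x'' h - y x'" by (simp add: blinfun.bilinear_simps)
  qed
  from conj_tangent[OF E x this] have "m' \<le> x'' x' + x'' g" by (simp add: blinfun.bilinear_simps)
  moreover have "x'' g \<le> B * norm g" using blinfun_le[of x'' g] mult_right_mono[OF B, of "norm g"] by simp
  ultimately show False using e by (simp add: m'_def)
qed


lemma monotone_opD: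
  assumes "monotone_op S" "(x, x') \<in> graph S" "(y, y') \<in> graph S"
  shows "blinfun_apply (x' - y') (x - y) \<ge> 0"
proof -
  have "\<forall>(y, y')\<in>graph S. (blinfun_apply x' - blinfun_apply y') (x - y) \<ge> 0"
    using bspec[OF assms(1)[unfolded monotone_op_def] assms(2)] by (simp add: case_prod_unfold)
  from bspec[OF this assms(3)] show ?thesis by (simp add: blinfun.diff_left)
qed

text \<open>Maximality is \<open>assoc_op_maximal\<close>. For the net, a point of the closure is
  approximated by points of the hull, which the Bronsted-Rockafellar property moves to the graph;
  finite sets \<open>F\<close> and errors \<open>e\<close> index a filter base.\<close>

theorem strong_set_gossez_D:
  fixes E :: "('a::banach \<times> 'a dual \<times> real) set"
  assumes E: "strong_set E"
  shows "gossez_D (assoc_op E)"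
proof -
  let ?W = "assoc_op E"
  have mono: "monotone_op ?W"
    unfolding monotone_op_def graph_def using assoc_op_monotone[OF E] by (auto simp: blinfun.diff_left)
  have "graph R = graph ?W" if R: "monotone_op R" "graph ?W \<subseteq> graph R" for R
  proof (intro equalityI R subsetI)
    fix p assume p: "p \<in> graph R"
    have "snd p \<in> ?W (fst p)"
    proof (rule assoc_op_maximal[OF E])
      fix w w' assume "w' \<in> ?W w"
      then have "(w, w') \<in> graph R" using R by (auto simp: graph_def)
      then show "(snd p - w') (fst p - w) \<ge> 0" using R p by (intro monotone_opD[of R]) auto
    qed
    then show "p \<in> graph ?W" by (simp add: graph_def case_prod_unfold)
  qed
  then have max: "maximal_monotone ?W" unfolding maximal_monotone_def using mono by blast
  let ?H = "graph_hull ?W"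
  have H: "strong_set ?H" by (rule graph_hull_strong[OF E])
  obtain v0 v0' r0 where v0: "(v0, v0', r0) \<in> ?H" using strong_set_nonempty[OF H] by auto
  have net: "\<exists>F B. F \<noteq> bot \<and>
          eventually (\<lambda>p. p \<in> graph ?W \<and> norm (fst p) \<le> B \<and> norm (snd p) \<le> B) F \<and>
          (\<forall>y'::'a dual. ((\<lambda>p. blinfun_apply y' (fst p)) \<longlongrightarrow> blinfun_apply x'' y') F) \<and>
          (snd \<longlongrightarrow> x') F" if x: "x' \<in> gossez_closure ?W x''" for x' and x'' :: "'a bidual"
  proof -
    have conj: "conj_le ?H x' x'' (x'' x')"
    proof (rule graph_hull_conj_le)
      fix w w' assume "w' \<in> ?W w"
      then have "0 \<le> x'' (x' - w') - (x' - w') w" using x by (auto simp: gossez_closure_def graph_def)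
      then show "x' w + x'' w' - w' w \<le> x'' x'" by (simp add: blinfun.bilinear_simps)
    qed
    define B where "B = norm v0 + norm x'' + 1"
    have B: "norm v0 < B" "norm x'' \<le> B" "B > 0" by (auto simp: B_def add_nonneg_pos)
    \<comment> \<open>The slack in \<open>7 * e\<close> and in \<open>1 + 6 * norm f\<close> pays
      for the move of length at most \<open>6 * e\<close> from the hull to the graph.\<close>
    define A where "A = (\<lambda>(F, e). {p \<in> graph ?W. norm (fst p) \<le> B + 6 \<and> norm (snd p - x') \<le> 7 * e \<and>
        (\<forall>f\<in>F. \<bar>blinfun_apply f (fst p) - x'' f\<bar> \<le> e * (1 + 6 * norm f))})"
    define I where "I = {(F :: 'a dual set, e :: real). finite F \<and> 0 < e \<and> e \<le> 1}"
    have A: "A (F, e) \<noteq> {}" if Fe: "finite F" "0 < e" "e \<le> 1" for F e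
    proof -
      \<comment> \<open>Makes the gap \<open>r - v' v\<close> at most \<open>e\<^sup>2\<close>, as
        the Bronsted-Rockafellar property asks. Adding \<open>x'\<close> to \<open>F\<close> ties
        \<open>x' v\<close> to \<open>x'' x'\<close>.\<close>
      define d where "d = e\<^sup>2 / (2 + B)"
      have d: "d > 0" "(2 + B) * d = e\<^sup>2" using Fe B by (auto simp: d_def)
      have "1 * d \<le> (2 + B) * d" using B d by (intro mult_right_mono) auto
      also have "\<dots> \<le> e" using d Fe by (simp add: power2_eq_square mult_left_le)
      finally have de: "d \<le> e" by simp
      obtain v v' r where v: "(v, v', r) \<in> ?H" "norm v \<le> B" "norm (v' - x') < d"
        "\<And>f. f \<in> insert x' F \<Longrightarrow> \<bar>blinfun_apply f v - x'' f\<bar> < d" "r < x'' x' + d"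
        using strong_set_bounded_approximation[OF H conj, of "insert x' F" d, OF _ d(1) v0 B(1,2)] Fe by auto
      have "v' v = x' v + (v' - x') v" by (simp add: blinfun.bilinear_simps)
      moreover have "- (B * d) \<le> (v' - x') v"
        using blinfun_ge[of "v' - x'" v] mult_mono[of "norm (v' - x')" d "norm v" B] v d by (simp add: mult.commute)
      moreover have "x'' x' - d \<le> x' v" using v(4)[of x'] by simp
      ultimately have "r - v' v \<le> (2 + B) * d" using v(5) by (simp add: algebra_simps)
      then have "r - v' v \<le> e\<^sup>2" using d by simp
      from strong_set_bronsted_rockafellar[OF H v(1) this Fe(2)] obtain w w' where
        w: "w' \<in> assoc_op ?H w" "norm (w - v) \<le> 6 * e" "norm (w' - v') \<le> 6 * e" by blast
      have "w' \<in> ?W w" by (rule assoc_op_graph_hull[OF E w(1)])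
      moreover have "norm w \<le> B + 6" using norm_triangle_sub[of w v] v w Fe by simp
      moreover have "norm (w' - x') \<le> 7 * e"
        using norm_triangle_ineq[of "w' - v'" "v' - x'"] w v de by simp
      moreover have "\<bar>f w - x'' f\<bar> \<le> e * (1 + 6 * norm f)" if "f \<in> F" for f
      proof -
        have "\<bar>f (w - v)\<bar> \<le> norm f * (6 * e)"
          using norm_blinfun[of f "w - v"] mult_left_mono[OF w(2), of "norm f"] by simp
        moreover have "f w - x'' f = f (w - v) + (f v - x'' f)" by (simp add: blinfun.bilinear_simps)
        ultimately have "\<bar>f w - x'' f\<bar> \<le> norm f * (6 * e) + e" using v(4)[of f] that de by simp
        then show ?thesis by (simp add: algebra_simps)
      qed
      ultimately have "(w, w') \<in> A (F, e)" by (auto simp: A_def graph_def)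
      then show ?thesis by blast
    qed
    \<comment> \<open>The sets \<open>A i\<close> are nonempty and directed downwards, by union of
      the \<open>F\<close> and minimum of the \<open>e\<close>, so this filter is proper.\<close>
    define N where "N = (INF i\<in>I. principal (A i))"
    have N: "eventually (\<lambda>p. p \<in> A (F, e)) N" if "finite F" "0 < e" "e \<le> 1" for F e
      unfolding N_def by (rule eventually_INF1[of "(F, e)"]) (use that in \<open>auto simp: I_def eventually_principal\<close>)
    have "N \<noteq> bot"
    proof -
      have "(N = bot) = (\<exists>i\<in>I. principal (A i) = bot)"
        unfolding N_def
      proof (rule INF_filter_bot_base)
        fix i j assume i: "i \<in> I" and j: "j \<in> I"
        obtain F e where Fe: "i = (F, e)" by (metis surj_pair)
        obtain G d where Gd: "j = (G, d)" by (metis surj_pair)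
        have mono: "A (F', e') \<subseteq> A (G', d')" if "G' \<subseteq> F'" "e' \<le> d'" for F' G' e' d'
        proof
          fix p assume p: "p \<in> A (F', e')"
          have "\<bar>blinfun_apply f (fst p) - x'' f\<bar> \<le> d' * (1 + 6 * norm f)" if "f \<in> G'" for f
          proof -
            have "\<bar>blinfun_apply f (fst p) - x'' f\<bar> \<le> e' * (1 + 6 * norm f)"
              using p that \<open>G' \<subseteq> F'\<close> by (auto simp: A_def)
            also have "\<dots> \<le> d' * (1 + 6 * norm f)" using \<open>e' \<le> d'\<close> by (intro mult_right_mono) auto
            finally show ?thesis .
          qed
          then show "p \<in> A (G', d')" using p \<open>e' \<le> d'\<close> by (simp add: A_def)
        qed
        have "A (F \<union> G, min e d) \<subseteq> A (F, e) \<inter> A (G, d)"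
          using mono[of F "F \<union> G" "min e d" e] mono[of G "F \<union> G" "min e d" d] by simp
        then show "\<exists>k\<in>I. principal (A k) \<le> inf (principal (A i)) (principal (A j))"
          using i j unfolding Fe Gd by (intro bexI[of _ "(F \<union> G, min e d)"]) (auto simp: I_def)
      qed
      then show ?thesis using A by (auto simp: I_def principal_eq_bot_iff)
    qed
    moreover have "eventually (\<lambda>p. p \<in> graph ?W \<and> norm (fst p) \<le> B + norm x' + 7 \<and> norm (snd p) \<le> B + norm x' + 7) N"
      using N[of "{}" 1]
    proof (rule eventually_mono)
      fix p assume p: "p \<in> A ({}, 1)"
      have "norm (snd p) \<le> norm x' + norm (snd p - x')" by (rule norm_triangle_sub)
      then show "p \<in> graph ?W \<and> norm (fst p) \<le> B + norm x' + 7 \<and> norm (snd p) \<le> B + norm x' + 7"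
        using p B(3) norm_ge_zero[of x'] unfolding A_def by (simp del: norm_ge_zero)
    qed auto
    moreover have "((\<lambda>p. blinfun_apply y' (fst p)) \<longlongrightarrow> blinfun_apply x'' y') N" for y'
    proof (rule tendstoI)
      fix e :: real assume e: "e > 0"
      define d where "d = min 1 (e / (2 * (1 + 6 * norm y')))"
      have P: "1 + 6 * norm y' > 0" by (simp add: add_pos_nonneg)
      have d: "0 < d" "d \<le> 1" using e P by (auto simp: d_def)
      have "d * (1 + 6 * norm y') \<le> (e / (2 * (1 + 6 * norm y'))) * (1 + 6 * norm y')"
        using P by (intro mult_right_mono) (auto simp: d_def)
      also have "\<dots> = e / 2" using P by (simp add: field_simps)
      finally have "d * (1 + 6 * norm y') < e" using e by simp
      then show "eventually (\<lambda>p. dist (y' (fst p)) (x'' y') < e) N"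
        using N[OF _ d, of "{y'}"] by (auto simp: A_def dist_real_def elim!: eventually_mono)
    qed
    moreover have "(snd \<longlongrightarrow> x') N"
    proof (rule tendstoI)
      fix e :: real assume e: "e > 0"
      have "eventually (\<lambda>p. p \<in> A ({}, min 1 (e / 8))) N" using e by (intro N) auto
      then show "eventually (\<lambda>p. dist (snd p) x' < e) N"
        using e by (auto simp: A_def dist_norm elim!: eventually_mono)
    qed
    ultimately show ?thesis by blast
  qed
  show ?thesis unfolding gossez_D_def using max net by (auto simp: graph_def)
qed

section \<open>Representative functions and parallel sums\<close>

definition real_epigraph :: "('a::real_normed_vector \<times> 'a dual \<Rightarrow> ereal) \<Rightarrow> ('a \<times> 'a dual \<times> real) set" where
  "real_epigraph h = {(x, x', s). h (x, x') \<le> ereal s}"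

lemma real_epigraph_convex:
  assumes "convex_ereal h"
  shows "convex (real_epigraph h)"
proof (rule convexI)
  fix p q and u v :: real
  assume pq: "p \<in> real_epigraph h" "q \<in> real_epigraph h" and uv: "0 \<le> u" "0 \<le> v" "u + v = 1"
  obtain x x' s where p: "p = (x, x', s)" by (metis surj_pair)
  obtain y y' t where q: "q = (y, y', t)" by (metis surj_pair)
  have v: "v = 1 - u" using uv by simp
  show "u *\<^sub>R p + v *\<^sub>R q \<in> real_epigraph h"
  proof (cases "u = 0 \<or> u = 1")
    case True then show ?thesis using pq v by auto
  next
    case False
    then have "h (u *\<^sub>R (x, x') + (1 - u) *\<^sub>R (y, y')) \<le> ereal u * h (x, x') + ereal (1 - u) * h (y, y')"
      using assms uv unfolding convex_ereal_def by simp
    also have "\<dots> \<le> ereal u * ereal s + ereal (1 - u) * ereal t"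
      using pq uv unfolding p q by (intro add_mono ereal_mult_left_mono) (auto simp: real_epigraph_def)
    finally show ?thesis by (simp add: p q v real_epigraph_def)
  qed
qed

lemma real_epigraph_closed:
  assumes "lsc_ereal h"
  shows "closed (real_epigraph h)"
  unfolding closed_sequential_limits
proof (intro allI impI, elim conjE)
  fix f l assume f: "\<forall>n. f n \<in> real_epigraph h" and lim: "f \<longlonglongrightarrow> l"
  obtain x x' s where l: "l = (x, x', s)" by (metis surj_pair)
  have f': "h (fst (f n), fst (snd (f n))) \<le> ereal (snd (snd (f n)))" for n
    using f[rule_format, of n] by (auto simp: real_epigraph_def case_prod_unfold)
  have lim1: "(\<lambda>n. (fst (f n), fst (snd (f n)))) \<longlonglongrightarrow> (x, x')" and lim2: "(\<lambda>n. snd (snd (f n))) \<longlonglongrightarrow> s"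
    using tendsto_Pair[OF tendsto_fst[OF lim] tendsto_fst[OF tendsto_snd[OF lim]]] tendsto_snd[OF tendsto_snd[OF lim]]
    by (simp_all add: l)
  show "l \<in> real_epigraph h"
  proof (rule ccontr)
    assume "l \<notin> real_epigraph h"
    then have "ereal s < h (x, x')" by (simp add: l real_epigraph_def not_le)
    then obtain t where t: "ereal s < ereal t" "ereal t < h (x, x')" using ereal_dense2 by blast
    have "eventually (\<lambda>w. ereal t < h w) (nhds (x, x'))" using assms t(2) by (simp add: lsc_ereal_def)
    from eventually_compose_filterlim[OF this lim1]
    have "\<forall>\<^sub>F n in sequentially. ereal t < h (fst (f n), fst (snd (f n)))" .
    moreover have "\<forall>\<^sub>F n in sequentially. snd (snd (f n)) < t" using order_tendstoD(2)[OF lim2] t by simp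
    ultimately have "\<forall>\<^sub>F n in sequentially. False"
    proof eventually_elim
      case (elim n)
      then show ?case using f'[of n] by (meson ereal_less_eq(3) less_le_not_le not_le order_trans)
    qed
    then show False by simp
  qed
qed

text \<open>Presents the projected domain as a linear image of the epigraph, which is closed and
  convex for a representative function; this is the form needed for the openness results.\<close>

lemma real_epigraph_pr: "(\<lambda>c. fst (snd c)) ` real_epigraph h = snd ` edom h"
proof (intro equalityI subsetI)
  fix a assume "a \<in> snd ` edom h"
  then obtain u where "h (u, a) < \<infinity>" by (auto simp: edom_def)
  then obtain s where "h (u, a) \<le> ereal s" by (cases "h (u, a)") auto
  then show "a \<in> (\<lambda>c. fst (snd c)) ` real_epigraph h" by (force simp: real_epigraph_def)
next
  fix a assume "a \<in> (\<lambda>c. fst (snd c)) ` real_epigraph h"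
  then obtain u s where "h (u, a) \<le> ereal s" by (auto simp: real_epigraph_def)
  then have "h (u, a) < \<infinity>" by (auto simp: order_le_less_trans)
  then show "a \<in> snd ` edom h" by (force simp: edom_def)
qed

lemma real_epigraph_graph:
  assumes "representative S h" "x' \<in> S x"
  shows "(x, x', blinfun_apply x' x) \<in> real_epigraph h"
  using assms by (auto simp: representative_def graph_def real_epigraph_def coupling_def)

lemma real_epigraph_strong_set:
  fixes S :: "'a::real_normed_vector \<Rightarrow> 'a dual set"
  assumes h: "strong_representative S h"
  shows "strong_set (real_epigraph h)"
proof -
  have r: "representative S h" using h by (simp add: strong_representative_def)
  have "blinfun_apply x' x \<le> s" if s: "(x, x', s) \<in> real_epigraph h" for x x' s
  proof -
    have "ereal (coupling (x, x')) \<le> h (x, x')" using r by (simp add: representative_def)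
    also have "\<dots> \<le> ereal s" using s by (simp add: real_epigraph_def)
    finally show ?thesis by (simp add: coupling_def)
  qed
  moreover have "x'' x' \<le> b" if b: "conj_le (real_epigraph h) x' x'' b" for x' x'' b
  proof -
    have "conj_fun h (x', x'') \<le> ereal b"
      unfolding conj_fun_def
    proof (rule SUP_least)
      fix p :: "'a \<times> 'a dual"
      obtain y y' where p: "p = (y, y')" by (metis surj_pair)
      show "ereal (blinfun_apply (fst (x', x'')) (fst p) + blinfun_apply (snd (x', x'')) (snd p)) - h p \<le> ereal b"
      proof (cases "h p")
        case (real s)
        then have "(y, y', s) \<in> real_epigraph h" by (simp add: real_epigraph_def p)
        then have "x' y + x'' y' - s \<le> b" using b by (auto simp: conj_le_def)
        then show ?thesis unfolding real by (simp add: p)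
      next
        case MInf
        then show ?thesis using r unfolding representative_def
          by (metis ereal_infty_less_eq(2) PInfty_neq_ereal(1) MInfty_neq_ereal(1))
      qed simp
    qed
    moreover have "ereal (x'' x') \<le> conj_fun h (x', x'')" using h by (simp add: strong_representative_def)
    ultimately show ?thesis by (metis ereal_less_eq(3) order_trans)
  qed
  ultimately show ?thesis
    unfolding strong_set_def using real_epigraph_convex r by (auto simp: representative_def)
qed

text \<open>An empty graph would be properly contained in the graph of the zero operator, which is
  monotone.\<close>

lemma maximal_monotone_nonempty:
  fixes S :: "'a::real_normed_vector \<Rightarrow> 'a dual set"
  assumes "maximal_monotone S"
  shows "range_mf S \<noteq> {}"
proof
  assume "range_mf S = {}"
  then have "graph S = {}" by (auto simp: range_mf_def graph_def)
  moreover have "graph (\<lambda>x::'a. {0 :: 'a dual}) = graph S"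
  proof -
    have "monotone_op (\<lambda>x::'a. {0 :: 'a dual})" by (auto simp: monotone_op_def graph_def)
    then show ?thesis using assms \<open>graph S = {}\<close> unfolding maximal_monotone_def by blast
  qed
  ultimately show False by (auto simp: graph_def)
qed

text \<open>Primal counterpart of \<open>conj_tangent\<close>: contact with the coupling now occurs
  at a point of \<open>E\<close> itself.\<close>

lemma convex_graph_tangent:
  assumes E: "strong_set E" and y: "(y, y', blinfun_apply y' y) \<in> E" and x: "(x, x', s) \<in> E"
  shows "y' x + x' y \<le> y' y + s"
proof (rule convex_tangent_le)
  fix t :: real assume t: "0 < t" "t < 1"
  have "(1 - t) *\<^sub>R (y, y', blinfun_apply y' y) + t *\<^sub>R (x, x', s) \<in> E"
    using t x y by (intro convexD[OF strong_setD(1)[OF E]]) auto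
  then have "((1 - t) *\<^sub>R y' + t *\<^sub>R x') ((1 - t) *\<^sub>R y + t *\<^sub>R x) \<le> (1 - t) * y' y + t * s"
    by (intro strong_setD(2)[OF E]) simp
  then show "(1 - t)\<^sup>2 * y' y + t * (1 - t) * (y' x + x' y) + t\<^sup>2 * x' x \<le> (1 - t) * y' y + t * s"
    by (simp add: blinfun.bilinear_simps algebra_simps power2_eq_square)
qed

lemma gossez_closureI:
  fixes x'' :: "'a::real_normed_vector bidual"
  assumes "\<And>y y'. y' \<in> S y \<Longrightarrow> blinfun_apply (x' - y') y \<le> x'' (x' - y')"
  shows "x' \<in> gossez_closure S x''"
  using assms by (auto simp: gossez_closure_def graph_def blinfun.diff_left)

text \<open>From right to left, test with the lifted graph points. From left to right, use the
  bounded net of type (D): boundedness makes the coupling converge along it, and the tangent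
  inequalities at its points pass to the limit.\<close>

theorem gossez_closure_iff_conj_le:
  assumes S: "gossez_D S" and h: "strong_representative S h"
  shows "x' \<in> gossez_closure S x'' \<longleftrightarrow> conj_le (real_epigraph h) x' x'' (x'' x')"
proof
  have r: "representative S h" using h by (simp add: strong_representative_def)
  note E = real_epigraph_strong_set[OF h]
  {
    assume "conj_le (real_epigraph h) x' x'' (x'' x')"
    then have "x' y + x'' y' - y' y \<le> x'' x'" if "y' \<in> S y" for y y'
      using real_epigraph_graph[of S h, OF r that] by (auto simp: conj_le_def)
    then show "x' \<in> gossez_closure S x''"
      by (intro gossez_closureI) (fastforce simp: blinfun.bilinear_simps)
  }
  assume "x' \<in> gossez_closure S x''"
  then have "(x'', x') \<in> graph (gossez_closure S)" by (simp add: graph_def)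
  then obtain F B where F: "F \<noteq> bot"
    and ev: "eventually (\<lambda>p. p \<in> graph S \<and> norm (fst p) \<le> B \<and> norm (snd p) \<le> B) F"
    and l1: "\<And>y'. ((\<lambda>p. blinfun_apply y' (fst p)) \<longlongrightarrow> blinfun_apply x'' y') F"
    and l2: "(snd \<longlongrightarrow> x') F"
    using S unfolding gossez_D_def by fastforce
  have "((\<lambda>p. norm (snd p - x') * B) \<longlongrightarrow> norm (x' - x') * B) F"
    by (intro tendsto_intros l2)
  then have lz: "((\<lambda>p. norm (snd p - x') * B) \<longlongrightarrow> 0) F" by simp
  have "eventually (\<lambda>p. norm ((snd p - x') (fst p)) \<le> norm (snd p - x') * B) F"
    using ev
  proof eventually_elim
    case (elim p)
    then show ?case using norm_blinfun[of "snd p - x'" "fst p"] mult_left_mono[of "norm (fst p)" B "norm (snd p - x')"] by simp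
  qed
  then have "((\<lambda>p. (snd p - x') (fst p)) \<longlongrightarrow> 0) F" using lz by (rule Lim_null_comparison)
  from tendsto_add[OF l1[of x'] this] have lc: "((\<lambda>p. blinfun_apply (snd p) (fst p)) \<longlongrightarrow> x'' x') F"
    by (simp add: blinfun.bilinear_simps)
  show "conj_le (real_epigraph h) x' x'' (x'' x')"
    unfolding conj_le_def
  proof clarify
    fix y y' s assume y: "(y, y', s) \<in> real_epigraph h"
    have "eventually (\<lambda>p. blinfun_apply (snd p) y + blinfun_apply y' (fst p) \<le> blinfun_apply (snd p) (fst p) + s) F"
      using ev
    proof eventually_elim
      case (elim p)
      then have "(fst p, snd p, blinfun_apply (snd p) (fst p)) \<in> real_epigraph h"
        by (intro real_epigraph_graph[OF r]) (auto simp: graph_def)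
      from convex_graph_tangent[OF E this y] show ?case by simp
    qed
    moreover have "((\<lambda>p. blinfun_apply (snd p) y + blinfun_apply y' (fst p)) \<longlongrightarrow> x' y + x'' y') F"
      by (intro tendsto_add l1 blinfun.tendsto tendsto_const l2)
    moreover have "((\<lambda>p. blinfun_apply (snd p) (fst p) + s) \<longlongrightarrow> x'' x' + s) F"
      by (intro tendsto_add lc tendsto_const)
    ultimately have "x' y + x'' y' \<le> x'' x' + s" using F tendsto_le by blast
    then show "x' y + x'' y' - s \<le> x'' x'" by simp
  qed
qed

section \<open>Affine hulls of differences of ranges and domains\<close>

text \<open>A positive lower bound \<open>d\<close> for the distance from \<open>y\<close> to
  \<open>L\<close> is linearised with penalty constant 1; a functional bounded below on a subspace
  vanishes there.\<close>

lemma closed_subspace_separation: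
  fixes L :: "'v::real_normed_vector set"
  assumes L: "subspace L" "closed L" and y: "y \<notin> L"
  shows "\<exists>f :: 'v \<Rightarrow>\<^sub>L real. (\<forall>x\<in>L. f x = 0) \<and> f y \<noteq> 0"
proof -
  have ne: "L \<noteq> {}" using L subspace_0 by auto
  obtain d where d: "d > 0" "\<And>x. x \<in> L \<Longrightarrow> d \<le> dist y x"
    using L(2) y unfolding closed_def open_contains_ball by (force simp: subset_eq not_less)
  have "\<exists>f :: 'v \<Rightarrow>\<^sub>L real. \<forall>c\<in>L. d \<le> f (c - y) + 0"
  proof (rule norm_penalty_linear[OF ne, where K = 1])
    show "convex_on L (\<lambda>_. 0 :: real)" by (simp add: convex_on_const subspace_imp_convex L)
    show "(1 - t) *\<^sub>R x + t *\<^sub>R z - y = (1 - t) *\<^sub>R (x - y) + t *\<^sub>R (z - y)" for x z t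
      by (simp add: algebra_simps)
    show "d \<le> 1 * norm (c - y) + 0" if "c \<in> L" for c using d(2)[OF that] by (simp add: dist_norm norm_minus_commute)
  qed simp
  then obtain f :: "'v \<Rightarrow>\<^sub>L real" where f: "\<And>c. c \<in> L \<Longrightarrow> d \<le> f c - f y" by (auto simp: blinfun.diff_right)
  have "f x = 0" if x: "x \<in> L" for x
  proof (rule ccontr)
    assume nz: "f x \<noteq> 0"
    have "((f y + d - 1) / f x) *\<^sub>R x \<in> L" using L x by (simp add: subspace_scale)
    from f[OF this] show False using nz by (simp add: blinfun.scaleR_right)
  qed
  moreover have "f y \<noteq> 0" using f[OF subspace_0[OF L(1)]] d(1) by (auto simp: blinfun.zero_right)
  ultimately show ?thesis by blast
qed

text \<open>A functional annihilating the differences of the range moves \<open>y\<close> in the bidual without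
  leaving the closure of \<open>S\<close>; the conjugate can only stay finite along this line if the domain of
  \<open>h\<close> is annihilated as well.\<close>

lemma range_direction_contains_domain:
  fixes S :: "'a::real_normed_vector \<Rightarrow> 'a dual set"
  assumes S: "gossez_D S" and h: "strong_representative S h" and L: "subspace L" "closed L"
    and R: "\<And>p q. p \<in> range_mf S \<Longrightarrow> q \<in> range_mf S \<Longrightarrow> p - q \<in> L"
    and y: "y' \<in> range_mf S" and x: "x' \<in> snd ` edom h"
  shows "x' - y' \<in> L"
proof (rule ccontr)
  assume "x' - y' \<notin> L"
  from closed_subspace_separation[OF L this] obtain w :: "'a bidual" where w: "\<And>z. z \<in> L \<Longrightarrow> w z = 0" "w (x' - y') \<noteq> 0"
    by blast
  obtain y where y: "y' \<in> S y" using y by (auto simp: range_mf_def)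
  obtain x s where x: "(x, x', s) \<in> real_epigraph h"
    using x unfolding real_epigraph_pr[symmetric] by auto
  \<comment> \<open>An inequality valid for all real \<open>t\<close> forces the coefficient of
    \<open>t\<close> to vanish, against the choice of \<open>w\<close>.\<close>
  have "y' x + x' y - s - y' y + t * w (x' - y') \<le> 0" for t
  proof -
    have "y' \<in> gossez_closure S (dual_eval y + t *\<^sub>R w)"
    proof (rule gossez_closureI)
      fix z z' assume z: "z' \<in> S z"
      have "0 \<le> blinfun_apply (y' - z') (y - z)"
        using S y z by (intro monotone_opD[of S]) (auto simp: gossez_D_def maximal_monotone_def graph_def)
      moreover have "w (y' - z') = 0"
        using z y by (intro w(1) R) (auto simp: range_mf_def)
      ultimately show "(y' - z') z \<le> (dual_eval y + t *\<^sub>R w) (y' - z')"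
        by (simp add: blinfun.bilinear_simps)
    qed
    then have "conj_le (real_epigraph h) y' (dual_eval y + t *\<^sub>R w) ((dual_eval y + t *\<^sub>R w) y')"
      using gossez_closure_iff_conj_le[OF S h] by blast
    then show ?thesis using x by (fastforce simp: conj_le_def blinfun.bilinear_simps algebra_simps)
  qed
  from this[of "(1 - (y' x + x' y - s - y' y)) / w (x' - y')"] show False using w(2) by simp
qed

lemma set_diff_mono: "A \<subseteq> A' \<Longrightarrow> B \<subseteq> B' \<Longrightarrow> set_diff A B \<subseteq> set_diff A' B'"
  unfolding set_diff_def by blast

text \<open>Convexity is used one argument at a time: with one point fixed, the admissible other
  points form a convex set, a preimage of the affine hull.\<close>

lemma set_diff_hull_subset: "set_diff (convex hull A) (convex hull B) \<subseteq> affine hull (set_diff A B)"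
proof -
  let ?H = "affine hull (set_diff A B)"
  have conv: "convex {x. x - b \<in> ?H}" "convex {x. b - x \<in> ?H}" for b
  proof -
    have *: "u *\<^sub>R x + v *\<^sub>R y - b = u *\<^sub>R (x - b) + v *\<^sub>R (y - b)"
      "b - (u *\<^sub>R x + v *\<^sub>R y) = u *\<^sub>R (b - x) + v *\<^sub>R (b - y)" if "u + v = 1" for u v :: real and x y
    proof -
      have v: "v = 1 - u" using that by simp
      show "u *\<^sub>R x + v *\<^sub>R y - b = u *\<^sub>R (x - b) + v *\<^sub>R (y - b)"
        "b - (u *\<^sub>R x + v *\<^sub>R y) = u *\<^sub>R (b - x) + v *\<^sub>R (b - y)" by (simp_all add: v algebra_simps)
    qed
    have H: "affine ?H" by (rule affine_affine_hull)
    show "convex {x. x - b \<in> ?H}" "convex {x. b - x \<in> ?H}"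
      using H unfolding affine_def by (auto intro!: convexI simp: *)
  qed
  have 1: "convex hull A \<subseteq> {x. x - b \<in> ?H}" if "b \<in> B" for b
    using that conv by (intro hull_minimal) (auto simp: set_diff_def intro!: hull_inc)
  have "convex hull B \<subseteq> {b. a - b \<in> ?H}" if "a \<in> convex hull A" for a
    using 1 that conv by (intro hull_minimal) auto
  then show ?thesis by (auto simp: set_diff_def)
qed

text \<open>The inclusions force equal affine hulls, hence the same directions in \<open>icr\<close>
  and the same closedness test in \<open>ic\<close>.\<close>

lemma ic_mono:
  fixes D E :: "'b::real_normed_vector set"
  assumes ne: "D \<noteq> {}" and DE: "D \<subseteq> E" and E: "E \<subseteq> affine hull D"
  shows "ic D \<subseteq> ic E"
proof -
  have aff: "affine hull E = affine hull D"
    by (intro antisym hull_minimal hull_mono E DE affine_affine_hull)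
  obtain a where a: "a \<in> affine hull D" using ne by (auto intro: hull_inc)
  have "affine hull (set_diff E E) = (\<lambda>x. - a + x) ` (affine hull E)"
    using a unfolding aff[symmetric] by (subst affine_hull_direction(1)[of a E]) (auto simp: image_image)
  moreover have "affine hull (set_diff D D) = (\<lambda>x. - a + x) ` (affine hull D)"
    using a by (subst affine_hull_direction(1)[of a D]) (auto simp: image_image)
  ultimately have "affine hull (set_diff E E) = affine hull (set_diff D D)" using aff by simp
  then have "icr D \<subseteq> icr E" using DE unfolding icr_def by blast
  then show ?thesis using aff by (simp add: ic_def)
qed

lemma ic_set_diff_convex_hull:
  assumes "A \<noteq> {}" "B \<noteq> {}"
  shows "ic (set_diff A B) \<subseteq> ic (set_diff (convex hull A) (convex hull B))"
proof (rule ic_mono[OF _ _ set_diff_hull_subset])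
  show "set_diff A B \<noteq> {}" using assms by (auto simp: set_diff_def)
  show "set_diff A B \<subseteq> set_diff (convex hull A) (convex hull B)"
    by (intro set_diff_mono hull_subset)
qed

lemma convex_hull_range_subset:
  assumes h: "strong_representative S h"
  shows "convex hull (range_mf S) \<subseteq> snd ` edom h"
proof (rule hull_minimal)
  show "range_mf S \<subseteq> snd ` edom h"
    using real_epigraph_graph[of S h] h unfolding real_epigraph_pr[symmetric]
    by (force simp: range_mf_def strong_representative_def)
  show "convex (snd ` edom h)"
    unfolding real_epigraph_pr[symmetric]
    by (rule convex_linear_image) (auto intro: linearI strong_setD(1)[OF real_epigraph_strong_set[OF h]])
qed

text \<open>If the affine hull on the left is not closed, the left side is empty. Otherwise its
  direction space is closed and contains the differences within each range, so
  \<open>range_direction_contains_domain\<close> confines the domains to the same affine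
  hull.\<close>

lemma ic_convex_hull_range_subset:
  fixes S T :: "'a::real_normed_vector \<Rightarrow> 'a dual set"
  assumes S: "gossez_D S" "strong_representative S hS" and T: "gossez_D T" "strong_representative T hT"
  shows "ic (set_diff (convex hull (range_mf S)) (convex hull (range_mf T)))
    \<subseteq> ic (set_diff (snd ` edom hS) (snd ` edom hT))" (is "ic ?E \<subseteq> ic ?D")
proof (cases "closed (affine hull ?E)")
  case True
  have "maximal_monotone S" "maximal_monotone T" using S(1) T(1) by (simp_all add: gossez_D_def)
  then obtain y z where y: "y \<in> range_mf S" and z: "z \<in> range_mf T"
    using maximal_monotone_nonempty by blast
  have E: "p - q \<in> ?E" if "p \<in> range_mf S" "q \<in> range_mf T" for p q
    using that by (auto simp: set_diff_def intro!: hull_inc)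
  let ?L = "affine hull (set_diff ?E ?E)"
  have yz: "y - z \<in> affine hull ?E" by (rule hull_inc[OF E[OF y z]])
  note dir = affine_hull_direction[OF yz]
  have "?L = (\<lambda>x. - (y - z) + x) ` (affine hull ?E)" by (subst dir(1)) (simp add: image_image)
  then have clL: "closed ?L" using closed_translation[OF True, of "- (y - z)"] by (simp only:)
  have EL: "a - b \<in> ?L" if "a \<in> ?E" "b \<in> ?E" for a b
    using that unfolding set_diff_def[of ?E] by (intro hull_inc) blast
  \<comment> \<open>Differences within one range arise from two differences of ranges with the other
    point held fixed.\<close>
  have RS: "p - q \<in> ?L" if "p \<in> range_mf S" "q \<in> range_mf S" for p q
    using EL[OF E[OF that(1) z] E[OF that(2) z]] by simp
  have RT: "p - q \<in> ?L" if "p \<in> range_mf T" "q \<in> range_mf T" for p q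
    using EL[OF E[OF y that(2)] E[OF y that(1)]] by simp
  show ?thesis
  proof (rule ic_mono)
    show "?E \<noteq> {}" using E[OF y z] by auto
    show "?E \<subseteq> ?D"
      by (intro set_diff_mono convex_hull_range_subset S(2) T(2))
    show "?D \<subseteq> affine hull ?E"
    proof
      fix d assume "d \<in> ?D"
      then obtain a b where ab: "d = a - b" "a \<in> snd ` edom hS" "b \<in> snd ` edom hT" by (auto simp: set_diff_def)
      have "a - y \<in> ?L" by (rule range_direction_contains_domain[OF S dir(2) clL RS y ab(2)])
      moreover have "b - z \<in> ?L" by (rule range_direction_contains_domain[OF T dir(2) clL RT z ab(3)])
      ultimately have "(a - y) - (b - z) \<in> ?L" by (rule subspace_diff[OF dir(2)])
      moreover have "d = (y - z) + ((a - y) - (b - z))" by (simp add: ab)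
      ultimately show "d \<in> affine hull ?E" by (subst dir(1)) blast
    qed
  qed
qed (simp add: ic_def)

section \<open>The parallel sum\<close>

text \<open>Points above the partial infimal convolution in the primal variable, with the dual
  variable shared. The infimum need not be attained, so this need not be a full epigraph.\<close>

definition parallel_epi :: "('a::real_normed_vector \<times> 'a dual \<times> real) set \<Rightarrow> ('a \<times> 'a dual \<times> real) set \<Rightarrow> ('a \<times> 'a dual \<times> real) set" where
  "parallel_epi P Q = {(u + v, a, s + t) | u v a s t. (u, a, s) \<in> P \<and> (v, a, t) \<in> Q}"

lemma parallel_epi_convex:
  assumes "convex P" "convex Q"
  shows "convex (parallel_epi P Q)"
proof (rule convexI)
  fix p q and l m :: real
  assume pq: "p \<in> parallel_epi P Q" "q \<in> parallel_epi P Q" and lm: "0 \<le> l" "0 \<le> m" "l + m = 1"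
  obtain u v a s t where p: "p = (u + v, a, s + t)" "(u, a, s) \<in> P" "(v, a, t) \<in> Q"
    using pq(1) unfolding parallel_epi_def by blast
  obtain u' v' a' s' t' where q: "q = (u' + v', a', s' + t')" "(u', a', s') \<in> P" "(v', a', t') \<in> Q"
    using pq(2) unfolding parallel_epi_def by blast
  have "(l *\<^sub>R u + m *\<^sub>R u', l *\<^sub>R a + m *\<^sub>R a', l * s + m * s') \<in> P"
    "(l *\<^sub>R v + m *\<^sub>R v', l *\<^sub>R a + m *\<^sub>R a', l * t + m * t') \<in> Q"
    using convexD[OF assms(1) p(2) q(2) lm] convexD[OF assms(2) p(3) q(3) lm] by simp_all
  moreover have "l *\<^sub>R p + m *\<^sub>R q = ((l *\<^sub>R u + m *\<^sub>R u') + (l *\<^sub>R v + m *\<^sub>R v'), l *\<^sub>R a + m *\<^sub>R a', (l * s + m * s') + (l * t + m * t'))"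
    by (simp add: p q algebra_simps)
  ultimately show "l *\<^sub>R p + m *\<^sub>R q \<in> parallel_epi P Q"
    unfolding parallel_epi_def by blast
qed

text \<open>Exactness in Attouch-Brezis duality: equality of the two dual variables is treated as
  the constraint \<open>j = 0\<close>, its multiplier \<open>f\<close> splits \<open>x''\<close>,
  and a supremum over \<open>P\<close> splits \<open>b\<close>.\<close>

lemma parallel_epi_conj_split:
  fixes P Q :: "('a::banach \<times> 'a dual \<times> real) set"
  defines "D \<equiv> set_diff ((\<lambda>c. fst (snd c)) ` P) ((\<lambda>c. fst (snd c)) ` Q)"
  assumes P: "convex P" "closed P" "P \<noteq> {}" and Q: "convex Q" "closed Q" "Q \<noteq> {}"
    and D: "0 \<in> ic D" and x: "conj_le (parallel_epi P Q) x' x'' b"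
  shows "\<exists>u v c d. u + v = x'' \<and> c + d = b \<and> conj_le P x' u c \<and> conj_le Q x' v d"
proof -
  let ?C = "P \<times> Q"
  define j where "j = (\<lambda>c :: ('a \<times> 'a dual \<times> real) \<times> 'a \<times> 'a dual \<times> real. fst (snd (fst c)) - fst (snd (snd c)))"
  define k where "k = (\<lambda>c :: ('a \<times> 'a dual \<times> real) \<times> 'a \<times> 'a dual \<times> real.
    snd (snd (fst c)) + snd (snd (snd c)) - blinfun_apply x' (fst (fst c)) - blinfun_apply x' (fst (snd c)) - blinfun_apply x'' (fst (snd (fst c))))"
  have j: "bounded_linear j" unfolding j_def
    by (intro bounded_linear_sub bounded_linear_fst_comp bounded_linear_snd_comp bounded_linear_ident)
  have k: "bounded_linear k" unfolding k_def
    by (intro bounded_linear_sub bounded_linear_add bounded_linear_compose[OF blinfun.bounded_linear_right]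
        bounded_linear_fst_comp bounded_linear_snd_comp bounded_linear_ident)
  interpret j: bounded_linear j by (rule j)
  interpret k: bounded_linear k by (rule k)
  have jC: "j ` ?C = D" unfolding D_def set_diff_def j_def by force
  have cl: "closed (affine hull D)" and icr: "0 \<in> icr D" using D by (auto simp: ic_def split: if_splits)
  have C: "convex ?C" "closed ?C" "?C \<noteq> {}" using P Q by (auto intro: convex_Times closed_Times)
  \<comment> \<open>Small vectors have preimages in a fixed ball, on which the linear cost
    \<open>k\<close> is bounded; this is the qualification for the multiplier.\<close>
  obtain N d where d: "d > 0" "\<And>v. v \<in> affine hull D \<Longrightarrow> norm v \<le> d \<Longrightarrow> \<exists>c\<in>?C. norm c \<le> N \<and> j c = v"
    using icr_convex_image_open[OF C j, of 0] cl icr unfolding jC diff_0_right by blast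
  obtain K where K: "K \<ge> 0" "\<And>c. norm (k c) \<le> norm c * K" using k.nonneg_bounded by blast
  have "D \<noteq> {}" using C(3) jC by blast
  then have "0 \<in> affine hull D" using icr_subset[of D] icr by (auto intro: hull_inc)
  then have sub: "subspace (affine hull D)" by (metis affine_hull_span_0 subspace_span)
  have "\<exists>f :: 'a bidual. \<forall>c\<in>?C. - b \<le> f (j c) + k c"
  proof (rule qualified_constraint_multiplier[OF C(3) _ _ sub _ d(1), where M = "N * K"])
    show "convex_on ?C k" by (intro convex_onI C(1)) (simp add: k.add k.scaleR)
    show "j ` ?C \<subseteq> affine hull D" unfolding jC by (rule hull_subset)
    show "\<exists>c\<in>?C. j c = v \<and> k c \<le> N * K" if v: "v \<in> affine hull D" "norm v \<le> d" for v
    proof -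
      obtain c where c: "c \<in> ?C" "norm c \<le> N" "j c = v" using d(2)[OF v] by blast
      have "k c \<le> norm c * K" using K(2)[of c] by simp
      also have "\<dots> \<le> N * K" using c K by (intro mult_right_mono) auto
      finally show ?thesis using c by blast
    qed
    show "- b \<le> k c" if "c \<in> ?C" "j c = 0" for c
    proof -
      obtain u a s v a' t where c: "c = ((u, a, s), (v, a', t))" by (metis surj_pair)
      have "(u + v, a, s + t) \<in> parallel_epi P Q" using that unfolding c j_def parallel_epi_def by auto
      then have "x' (u + v) + x'' a - (s + t) \<le> b" using x by (auto simp: conj_le_def)
      then show ?thesis by (simp add: c k_def blinfun.add_right)
    qed
  qed (auto simp: j.add j.scaleR)
  then obtain f :: "'a bidual" where f: "\<And>c. c \<in> ?C \<Longrightarrow> - b \<le> f (j c) + k c" by blast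
  define A where "A = (\<lambda>(u, a, s). blinfun_apply x' u + blinfun_apply (x'' - f) a - s)"
  define B where "B = (\<lambda>(v, a, t). blinfun_apply x' v + blinfun_apply f a - t)"
  have AB: "A p + B q \<le> b" if "p \<in> P" "q \<in> Q" for p q
  proof -
    obtain u a s where p: "p = (u, a, s)" by (metis surj_pair)
    obtain v a' t where q: "q = (v, a', t)" by (metis surj_pair)
    show ?thesis using f[of "(p, q)"] that by (simp add: A_def B_def j_def k_def p q blinfun.bilinear_simps)
  qed
  obtain q0 where q0: "q0 \<in> Q" using Q by auto
  have bdd: "bdd_above (A ` P)" by (rule bdd_aboveI2[of _ _ "b - B q0"]) (use AB[OF _ q0] in fastforce)
  have 1: "A p \<le> Sup (A ` P)" if "p \<in> P" for p using that bdd by (intro cSup_upper) auto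
  have 2: "B q \<le> b - Sup (A ` P)" if "q \<in> Q" for q
  proof -
    have "Sup (A ` P) \<le> b - B q" using P(3) AB[OF _ that] by (intro cSup_least) fastforce+
    then show ?thesis by simp
  qed
  have "conj_le P x' (x'' - f) (Sup (A ` P))" "conj_le Q x' f (b - Sup (A ` P))"
    using 1 2 by (fastforce simp: conj_le_def A_def B_def)+
  moreover have "(x'' - f) + f = x''" "Sup (A ` P) + (b - Sup (A ` P)) = b" by simp_all
  ultimately show ?thesis by blast
qed

text \<open>Splitting the conjugate shows both that the convolution set is strong and that its
  operator is the parallel sum; \<open>strong_set_gossez_D\<close> then applies.\<close>

theorem parallel_sum_gossez_D:
  fixes S T :: "'a::banach \<Rightarrow> 'a dual set"
  assumes S: "gossez_D S" "strong_representative S hS" and T: "gossez_D T" "strong_representative T hT"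
    and qual: "0 \<in> ic (set_diff (snd ` edom hS) (snd ` edom hT))"
  shows "gossez_D (parallel_sum S T)"
proof -
  let ?P = "real_epigraph hS" and ?Q = "real_epigraph hT"
  let ?E = "parallel_epi ?P ?Q"
  note P = real_epigraph_strong_set[OF S(2)] and Q = real_epigraph_strong_set[OF T(2)]
  have cl: "closed ?P" "closed ?Q"
    using S(2) T(2) by (auto intro!: real_epigraph_closed simp: strong_representative_def representative_def)
  have split: "\<exists>u v c d. u + v = x'' \<and> c + d = b \<and> conj_le ?P x' u c \<and> conj_le ?Q x' v d"
    if "conj_le ?E x' x'' b" for x' x'' b
    using qual unfolding real_epigraph_pr[symmetric]
    by (intro parallel_epi_conj_split strong_setD(1) P Q cl strong_set_nonempty that)
  have E: "strong_set ?E"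
    unfolding strong_set_def
  proof (intro conjI allI impI ballI)
    show "convex ?E" by (intro parallel_epi_convex strong_setD(1) P Q)
    fix p assume "p \<in> ?E"
    then obtain u v a s t where p: "p = (u + v, a, s + t)" "(u, a, s) \<in> ?P" "(v, a, t) \<in> ?Q"
      unfolding parallel_epi_def by blast
    have "a u + a v \<le> s + t" using strong_setD(2)[OF P p(2)] strong_setD(2)[OF Q p(3)] by simp
    then show "case p of (x, x', r) \<Rightarrow> blinfun_apply x' x \<le> r" by (simp add: p blinfun.add_right)
  next
    fix x' x'' b assume "conj_le ?E x' x'' b"
    from split[OF this] obtain u v c d where uv: "u + v = x''" "c + d = b" "conj_le ?P x' u c" "conj_le ?Q x' v d"
      by blast
    have "u x' + v x' \<le> c + d" using strong_setD(3)[OF P uv(3)] strong_setD(3)[OF Q uv(4)] by simp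
    then show "x'' x' \<le> b" using uv by (auto simp: blinfun.add_left)
  qed
  have "x' \<in> parallel_sum S T x \<longleftrightarrow> x' \<in> assoc_op ?E x" for x x'
  proof
    assume "x' \<in> parallel_sum S T x"
    then obtain u v where u: "conj_le ?P x' u (u x')" and v: "conj_le ?Q x' v (v x')" and uv: "\<And>f. u f + v f = blinfun_apply f x"
      unfolding parallel_sum_def gossez_closure_iff_conj_le[OF S] gossez_closure_iff_conj_le[OF T] by blast
    have "conj_le ?E x' (dual_eval x) (x' x)"
      unfolding conj_le_def
    proof
      fix p assume "p \<in> ?E"
      then obtain y z a s t where p: "p = (y + z, a, s + t)" "(y, a, s) \<in> ?P" "(z, a, t) \<in> ?Q"
        unfolding parallel_epi_def by blast
      have "x' y + u a - s \<le> u x'" "x' z + v a - t \<le> v x'" using u v p by (auto simp: conj_le_def)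
      then have "x' y + x' z + a x - (s + t) \<le> x' x" unfolding uv[symmetric] by simp
      then show "case p of (y, y', r) \<Rightarrow> blinfun_apply x' y + blinfun_apply (dual_eval x) y' - r \<le> blinfun_apply x' x"
        by (simp add: p blinfun.add_right)
    qed
    then show "x' \<in> assoc_op ?E x" by (simp add: assoc_op_def)
  next
    assume "x' \<in> assoc_op ?E x"
    then have "conj_le ?E x' (dual_eval x) (x' x)" by (simp add: assoc_op_def)
    from split[OF this] obtain u v c d where uv: "u + v = dual_eval x" "c + d = x' x" "conj_le ?P x' u c" "conj_le ?Q x' v d"
      by blast
    have sum: "u f + v f = blinfun_apply f x" for f
      using uv(1) by (metis blinfun.add_left dual_eval_apply)
    \<comment> \<open>The two lower bounds add up to the total \<open>c + d\<close>, so both are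
      equalities and each part lies on the respective closure.\<close>
    have "u x' \<le> c" "v x' \<le> d" using strong_setD(3)[OF P uv(3)] strong_setD(3)[OF Q uv(4)] by simp_all
    then have "c = u x'" "d = v x'" using sum[of x'] uv(2) by linarith+
    then have "x' \<in> gossez_closure S u" "x' \<in> gossez_closure T v"
      using uv gossez_closure_iff_conj_le[OF S] gossez_closure_iff_conj_le[OF T] by auto
    then show "x' \<in> parallel_sum S T x" using sum unfolding parallel_sum_def by blast
  qed
  then have "parallel_sum S T = assoc_op ?E" by (intro ext) blast
  then show ?thesis using strong_set_gossez_D[OF E] by simp
qed

theorem theorem4p2:
  fixes S T :: "'a::banach \<Rightarrow> ('a \<Rightarrow>\<^sub>L real) set"
    and hS hT :: "'a \<times> ('a \<Rightarrow>\<^sub>L real) \<Rightarrow> ereal"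
  assumes nontriv: "\<exists>x::'a. x \<noteq> 0"
    and DS: "gossez_D S" and DT: "gossez_D T"
    and hS: "strong_representative S hS" and hT: "strong_representative T hT"
    and dom: "snd ` edom hS \<inter> snd ` edom hT \<noteq> {}"
  shows "ic (set_diff (range_mf S) (range_mf T))
           \<subseteq> ic (set_diff (convex hull range_mf S) (convex hull range_mf T))
       \<and> ic (set_diff (convex hull range_mf S) (convex hull range_mf T))
           \<subseteq> ic (set_diff (snd ` edom hS) (snd ` edom hT))
       \<and> ic (set_diff (snd ` edom hS) (snd ` edom hT))
           = ri (set_diff (snd ` edom hS) (snd ` edom hT))
       \<and> ((0 \<in> ic (set_diff (range_mf S) (range_mf T))
            \<or> 0 \<in> ic (set_diff (convex hull range_mf S) (convex hull range_mf T)))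
          \<longrightarrow> gossez_D (parallel_sum S T))"
proof -
  have 1: "ic (set_diff (range_mf S) (range_mf T)) \<subseteq> ic (set_diff (convex hull range_mf S) (convex hull range_mf T))"
    using DS DT by (intro ic_set_diff_convex_hull maximal_monotone_nonempty) (auto simp: gossez_D_def)
  have 2: "ic (set_diff (convex hull range_mf S) (convex hull range_mf T)) \<subseteq> ic (set_diff (snd ` edom hS) (snd ` edom hT))"
    by (rule ic_convex_hull_range_subset[OF DS hS DT hT])
  \<comment> \<open>The difference of the projected domains is a linear image of this closed convex
    product.\<close>
  let ?C = "real_epigraph hS \<times> real_epigraph hT"
  let ?j = "\<lambda>c :: ('a \<times> 'a dual \<times> real) \<times> 'a \<times> 'a dual \<times> real. fst (snd (fst c)) - fst (snd (snd c))"
  have "ic (?j ` ?C) = ri (?j ` ?C)"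
  proof (rule ic_convex_image_eq_ri)
    show "convex ?C" "?C \<noteq> {}"
      using real_epigraph_strong_set[OF hS] real_epigraph_strong_set[OF hT]
      by (auto intro: convex_Times strong_setD(1) dest: strong_set_nonempty)
    show "closed ?C"
      using hS hT by (intro closed_Times real_epigraph_closed) (auto simp: strong_representative_def representative_def)
    show "bounded_linear ?j"
      by (intro bounded_linear_sub bounded_linear_fst_comp bounded_linear_snd_comp bounded_linear_ident)
  qed
  moreover have "?j ` ?C = set_diff (snd ` edom hS) (snd ` edom hT)"
    unfolding real_epigraph_pr[symmetric] set_diff_def by force
  ultimately have 3: "ic (set_diff (snd ` edom hS) (snd ` edom hT)) = ri (set_diff (snd ` edom hS) (snd ` edom hT))"
    by simp
  show ?thesis using 1 2 3 parallel_sum_gossez_D[OF DS hS DT hT] by blast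
qed

end
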